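(* Thompson's group $V$ has Serre's property FA.
   Context: Thompson's group $V$ is the group of right-continuous bijections of $[0,1)$ that map dyadic rational numbers to dyadic rational numbers, are differentiable except at finitely many points, all dyadic rationals, and are affine with slope a power $2^i$, $i\in\mathbb{Z}$, on each maximal interval of differentiability. A group $G$ acting simplicially on a simplicial tree $\Gamma$ acts without inversions if, whenever $g\in G$ leaves an edge $e$ invariant, $g$ acts as the identity on $e$. All simplicial actions on trees are assumed to be without inversions (after barycentric subdivision of the tree if necessary). A group $G$ has (Serre's) property FA if every simplicial action of $G$ on a tree $\Gamma$ has a fixed point, i.e. there is some $v\in\Gamma$ with $G\cdot v=v$. *)

theory Defs
  imports "HOL-Analysis.Analysis" "HOL-Algebra.Group_Action"
begin

section \<open>Thompson's group V\<close>

text \<open>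
  The domain is the half-open unit interval, so differentiability is taken within it; at the
  endpoint \<open>0\<close> this is one-sided differentiability from the right.
\<close>

definition diff_points :: "(real \<Rightarrow> real) \<Rightarrow> real set" where
  "diff_points f = {x \<in> {0..<1}. f differentiable (at x within {0..<1})}"

text \<open>
  The library constant \<^const>\<open>dyadics\<close> consists of the nonnegative dyadic rationals only,
  which is harmless inside the unit interval.  The maximal intervals of differentiability are the
  connected components of the set of points of differentiability.
\<close>

definition thompson_V_set :: "(real \<Rightarrow> real) set" where
  "thompson_V_set = {f \<in> Bij {0..<1}.
     (\<forall>x\<in>{0..<1}. continuous (at_right x) f) \<and>
     f ` (dyadics \<inter> {0..<1}) \<subseteq> dyadics \<and>
     finite ({0..<1} - diff_points f) \<and>
     {0..<1} - diff_points f \<subseteq> dyadics \<and>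
     (\<forall>I \<in> components (diff_points f). \<exists>(i::int) c. \<forall>x\<in>I. f x = 2 powi i * x + c)}"

definition thompson_V :: "(real \<Rightarrow> real) monoid" where
  "thompson_V = (BijGroup {0..<1})\<lparr>carrier := thompson_V_set\<rparr>"


section \<open>Simplicial trees and property FA\<close>

text \<open>
  A simplicial tree is given by its vertex set and its edges, an edge being the two-element set
  of its end points.  Trees are nonempty, but need be neither finite nor locally finite.
\<close>

locale simplicial_tree =
  fixes X :: "'v set" and E :: "'v set set"
  assumes edges: "\<And>e. e \<in> E \<Longrightarrow> e \<subseteq> X \<and> card e = 2"
    and nonempty: "X \<noteq> {}"
    and connected: "\<And>u v. u \<in> X \<Longrightarrow> v \<in> X \<Longrightarrow> (\<lambda>x y. {x, y} \<in> E)\<^sup>*\<^sup>* u v"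
    and acyclic: "\<not> (\<exists>xs. 3 \<le> length xs \<and> distinct xs \<and>
                    successively (\<lambda>x y. {x, y} \<in> E) xs \<and> {last xs, hd xs} \<in> E)"

locale simplicial_tree_action = group_action G X \<phi> + simplicial_tree X E
  for G :: "('a, 'b) monoid_scheme" (structure) and X :: "'v set" and E :: "'v set set"
    and \<phi> :: "'a \<Rightarrow> 'v \<Rightarrow> 'v" +
  assumes simplicial: "\<And>g e. g \<in> carrier G \<Longrightarrow> e \<in> E \<Longrightarrow> \<phi> g ` e \<in> E"
    and no_inversions:
      "\<And>g e v. g \<in> carrier G \<Longrightarrow> e \<in> E \<Longrightarrow> \<phi> g ` e = e \<Longrightarrow> v \<in> e \<Longrightarrow> \<phi> g v = v"

text \<open>
  HOL cannot quantify over types inside a formula, so the type of the vertices is a parameter;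
  a theorem with a free type variable in this place speaks about trees of arbitrary size.
  As actions are without inversions, a fixed point inside an edge forces its end points to be
  fixed, so fixed points are taken to be vertices.
\<close>

definition property_FA :: "'v itself \<Rightarrow> ('a, 'b) monoid_scheme \<Rightarrow> bool" where
  "property_FA _ G \<longleftrightarrow> group G \<and>
     (\<forall>(X::'v set) E \<phi>. simplicial_tree_action G X E \<phi> \<longrightarrow>
        (\<exists>v\<in>X. orbit G \<phi> v = {v}))"

end

(* Write (u v) for the element of V that exchanges the dyadic intervals coded by the disjoint
   binary words u and v. The four involutions a = (00 01), b = (01 10), c = (10 11), d = (1 00)
   generate V. Each of the sets {a, b, c}, {b, d} and {a, c, d} consists of permutations of the
   parts of a single finite dyadic partition, hence lies in a finite subgroup of V. A finite group
   acting on a tree without inversions fixes a vertex, because the centre of an orbit is a vertex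
   or an edge. So there are vertices p, q, r fixed by the three sets, and the median of
   p, q, r lies on the three geodesics between them. As the fixed points of a group
   element are closed under geodesics, the median is fixed by a, b, c and d, hence by V.

   To see that the four involutions generate V, all exchanges (u v) are first obtained by
   conjugation. An element carrying the parts of a finite dyadic partition P affinely to those of
   a partition Q is then reduced by induction on the size of P: both partitions contain a pair
   of sibling intervals, after composing with exchanges of parts of Q the siblings in P are
   carried to those in Q, and both pairs can be merged. *)
theory Submission
  imports Defs "HOL-Library.Sublist"
begin

section \<open>Simplicial trees\<close>

text \<open>All tree geometry rests on one consequence of acyclicity: a vertex has at most one
  neighbour that is not farther than itself from a given vertex \<open>a\<close>. Hence a path
  without backtracking that once moves away from \<open>a\<close> keeps moving away, and this
  dichotomy yields both medians and centres. No finite subgroup contains all four involutions, since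
  they generate an infinite group; the three sets are chosen so that each involution lies in two of
  them and thus fixes both ends of a geodesic through the median.

  The other obstacle is that V is defined by differentiability, while generation is an argument
  about tables that replace prefixes of binary words. An affine map with slope a power of two and
  dyadic values carries all sufficiently small standard dyadic intervals to standard ones, and right
  continuity settles the left end points. Conversely, an interval of differentiability may span many
  rows of a table; differentiability at their common end points then forces the formulas to
  coincide.\<close>

context simplicial_tree
begin

abbreviation adj :: "'v \<Rightarrow> 'v \<Rightarrow> bool" where
  "adj x y \<equiv> {x, y} \<in> E"

section \<open>Graph distance\<close>

definition gdist :: "'v \<Rightarrow> 'v \<Rightarrow> nat" where
  "gdist u v = (LEAST n. (adj ^^ n) u v)"

lemma adj_sym: "adj x y \<longleftrightarrow> adj y x"
  by (simp add: insert_commute)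

lemma adj_in: "adj x y \<Longrightarrow> x \<in> X \<and> y \<in> X"
  using edges by blast

lemma adj_neq: "adj x y \<Longrightarrow> x \<noteq> y"
  using edges by fastforce

lemma relpowp_adj_sym: "(adj ^^ n) u v \<Longrightarrow> (adj ^^ n) v u"
proof (induction n arbitrary: u v)
  case (Suc n)
  then obtain w where "(adj ^^ n) u w" "adj w v" by auto
  with Suc.IH have "(adj ^^ n) w u" "adj v w" by (auto simp: adj_sym)
  then show ?case by (meson relpowp_Suc_I2)
qed auto

lemma gdist_path: "u \<in> X \<Longrightarrow> v \<in> X \<Longrightarrow> (adj ^^ gdist u v) u v"
  using connected[of u v] rtranclp_imp_relpowp[of adj u v] unfolding gdist_def
  by (metis (mono_tags, lifting) LeastI)

lemma gdist_le: "(adj ^^ n) u v \<Longrightarrow> gdist u v \<le> n"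
  unfolding gdist_def by (rule Least_le)

lemma gdist_self [simp]: "gdist u u = 0"
  using gdist_le[of 0 u u] by simp

lemma gdist_eq_0: "u \<in> X \<Longrightarrow> v \<in> X \<Longrightarrow> gdist u v = 0 \<longleftrightarrow> u = v"
  using gdist_path[of u v] by auto

lemma gdist_sym: "u \<in> X \<Longrightarrow> v \<in> X \<Longrightarrow> gdist u v = gdist v u"
  by (meson gdist_le gdist_path relpowp_adj_sym order_antisym)

lemma gdist_triangle:
  assumes "u \<in> X" "v \<in> X" "w \<in> X"
  shows "gdist u w \<le> gdist u v + gdist v w"
  using gdist_le[of "gdist u v + gdist v w" u w] gdist_path[OF assms(1,2)] gdist_path[OF assms(2,3)]
  by (auto simp: relpowp_add)

lemma gdist_adj: "adj u v \<Longrightarrow> gdist u v = 1"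
  using gdist_le[of 1 u v] gdist_eq_0[of u v] adj_in adj_neq by fastforce

lemma gdist_adj_step:
  assumes "a \<in> X" "adj x y"
  shows "gdist a y \<le> Suc (gdist a x)"
  using gdist_triangle[of a x y] gdist_adj assms adj_in by fastforce

section \<open>Acyclicity: the unique step towards a vertex\<close>

lemma gdist_pred:
  assumes "a \<in> X" "v \<in> X" "gdist a v = Suc n"
  obtains w where "adj w v" "gdist a w = n"
proof -
  have "(adj ^^ Suc n) a v" using gdist_path assms by metis
  then obtain w where w: "(adj ^^ n) a w" "adj w v" by auto
  with gdist_le have "gdist a w \<le> n" by blast
  moreover have "Suc n \<le> Suc (gdist a w)"
    using gdist_adj_step[OF \<open>a \<in> X\<close> w(2)] assms by simp
  ultimately show thesis using that w by simp
qed

text \<open>Loop erasure: a walk that returns to an earlier vertex is cut back to it. The last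
  clause lets all later vertices inherit a restriction built into \<open>R\<close>, such as avoiding
  a given vertex.\<close>

lemma rtranclp_distinct_path:
  assumes "R\<^sup>*\<^sup>* x y"
  obtains xs where "xs \<noteq> []" "hd xs = x" "last xs = y" "distinct xs" "successively R xs"
    "\<forall>z\<in>set xs. z = x \<or> (\<exists>w. R w z)"
proof -
  have "\<exists>xs. xs \<noteq> [] \<and> hd xs = x \<and> last xs = y \<and> distinct xs \<and> successively R xs \<and>
    (\<forall>z\<in>set xs. z = x \<or> (\<exists>w. R w z))"
    using assms
  proof (induction rule: rtranclp_induct)
    case base
    show ?case by (rule exI[of _ "[x]"]) auto
  next
    case (step y z)
    then obtain xs where xs: "xs \<noteq> []" "hd xs = x" "last xs = y" "distinct xs" "successively R xs"
      "\<forall>z\<in>set xs. z = x \<or> (\<exists>w. R w z)" by blast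
    show ?case
    proof (cases "z \<in> set xs")
      case True
      then obtain ys zs where eq: "xs = ys @ z # zs" by (meson split_list)
      show ?thesis
        using xs by (intro exI[of _ "ys @ [z]"])
          (auto simp: eq successively_append_iff hd_append)
    next
      case False
      then show ?thesis
        using xs step.hyps(2) by (intro exI[of _ "xs @ [z]"])
          (auto simp: successively_append_iff)
    qed
  qed
  then show thesis using that by blast
qed

text \<open>Closing up a loop-free path from \<open>x\<close> to \<open>y\<close> through
  \<open>v\<close> would give a circuit with at least three vertices.\<close>

lemma no_detour:
  assumes "adj v x" "adj v y" "x \<noteq> y" "(\<lambda>p q. adj p q \<and> p \<noteq> v \<and> q \<noteq> v)\<^sup>*\<^sup>* x y"
  shows False
proof -
  obtain xs where xs: "xs \<noteq> []" "hd xs = x" "last xs = y" "distinct xs"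
    "successively (\<lambda>p q. adj p q \<and> p \<noteq> v \<and> q \<noteq> v) xs"
    "\<forall>z\<in>set xs. z = x \<or> (\<exists>w. adj w z \<and> w \<noteq> v \<and> z \<noteq> v)"
    by (rule rtranclp_distinct_path[OF assms(4)])
  have v: "v \<notin> set xs" using xs(6) adj_neq[OF assms(1)] by auto
  have "successively adj xs" using xs(5) by (rule successively_mono) auto
  moreover have "length xs \<ge> 2"
  proof (rule ccontr)
    assume "\<not> 2 \<le> length xs"
    moreover have "length xs \<noteq> 0" using xs(1) by simp
    ultimately have "length xs = 1" by linarith
    then have "x = y" using xs(2,3) by (cases xs) auto
    with assms show False by simp
  qed
  ultimately have "3 \<le> length (v # xs) \<and> distinct (v # xs) \<and> successively adj (v # xs)
     \<and> {last (v # xs), hd (v # xs)} \<in> E"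
    using xs v assms by (auto simp: successively_Cons adj_sym)
  with acyclic show False by blast
qed

text \<open>Walk from \<open>w\<close> to \<open>a\<close>, getting closer at each step: every
  vertex after \<open>w\<close> is strictly closer to \<open>a\<close> than \<open>v\<close> is, so
  it cannot be \<open>v\<close>.\<close>

lemma descent_avoids:
  assumes "a \<in> X" "v \<in> X" "w \<in> X" "gdist a w \<le> gdist a v" "w \<noteq> v"
  shows "(\<lambda>p q. adj p q \<and> p \<noteq> v \<and> q \<noteq> v)\<^sup>*\<^sup>* w a"
  using assms(3-)
proof (induction "gdist a w" arbitrary: w)
  case 0
  then show ?case using gdist_eq_0 assms by auto
next
  case (Suc n)
  obtain z where z: "adj z w" "gdist a z = n"
    using gdist_pred[of a w n] Suc assms by metis
  have "z \<noteq> v" using Suc z by auto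
  then have za: "(\<lambda>p q. adj p q \<and> p \<noteq> v \<and> q \<noteq> v)\<^sup>*\<^sup>* z a"
    using Suc z adj_in by (intro Suc.hyps(1)) auto
  have "(\<lambda>p q. adj p q \<and> p \<noteq> v \<and> q \<noteq> v) w z" using z \<open>z \<noteq> v\<close> Suc adj_sym[of z w] by auto
  then show ?case using za by (rule converse_rtranclp_into_rtranclp)
qed

text \<open>Two such neighbours would both be joined to \<open>a\<close>, hence to each other, while
  avoiding \<open>v\<close>. The non-strict inequality matters: it also excludes adjacent vertices
  at equal distance from \<open>a\<close>.\<close>

lemma closer_neighbour_unique:
  assumes "a \<in> X" "adj v x" "adj v y" "gdist a x \<le> gdist a v" "gdist a y \<le> gdist a v"
  shows "x = y"
proof (rule ccontr)
  assume "x \<noteq> y"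
  let ?R = "\<lambda>p q. adj p q \<and> p \<noteq> v \<and> q \<noteq> v"
  have X: "v \<in> X" "x \<in> X" "y \<in> X" "x \<noteq> v" "y \<noteq> v"
    using assms adj_in adj_neq by blast+
  have "?R\<^sup>*\<^sup>* x a" "?R\<^sup>*\<^sup>* y a"
    using descent_avoids assms X by auto
  moreover have "symp ?R" by (auto simp: symp_def adj_sym)
  ultimately have "?R\<^sup>*\<^sup>* x y"
    by (meson rtranclp_trans sympD symp_rtranclp)
  then show False using no_detour assms \<open>x \<noteq> y\<close> by blast
qed

lemma other_neighbour_farther:
  assumes "a \<in> X" "adj v x" "adj v y" "x \<noteq> y" "gdist a x \<le> gdist a v"
  shows "gdist a y = Suc (gdist a v)"
  using closer_neighbour_unique[OF assms(1,2,3,5)] gdist_adj_step[OF assms(1,3)] assms(4)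
  by linarith

lemma step_towards:
  assumes "x \<in> X" "w \<in> X" "x \<noteq> w"
  obtains y where "adj x y" "gdist w x = Suc (gdist w y)"
proof -
  obtain n where n: "gdist w x = Suc n"
    using gdist_eq_0[OF assms(2,1)] assms(3) by (metis not0_implies_Suc)
  obtain y where "adj y x" "gdist w y = n" by (rule gdist_pred[OF assms(2,1) n])
  with n that show thesis by (simp add: adj_sym)
qed

text \<open>Trees are bipartite: at equal distance, \<open>y\<close> and the neighbour of
  \<open>x\<close> on the way to \<open>a\<close> would be two neighbours of \<open>x\<close> that
  are not farther from \<open>a\<close>.\<close>

lemma adj_gdist_neq:
  assumes "a \<in> X" "adj x y"
  shows "gdist a x \<noteq> gdist a y"
proof
  assume eq: "gdist a x = gdist a y"
  have X: "x \<in> X" "y \<in> X" "x \<noteq> y" using assms adj_in adj_neq by auto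
  show False
  proof (cases "x = a")
    case True
    then show ?thesis using eq X gdist_eq_0 assms by (metis gdist_self)
  next
    case False
    obtain z where "adj x z" "gdist a x = Suc (gdist a z)"
      by (rule step_towards[OF X(1) assms(1) False])
    then show ?thesis
      using closer_neighbour_unique[OF assms(1), of x y z] assms eq by auto
  qed
qed

text \<open>The only neighbour of \<open>y\<close> closer to \<open>a\<close> is \<open>x\<close>.
  The next vertex towards \<open>w\<close> differs from \<open>x\<close>, so it is farther from
  \<open>a\<close> again, and the distances add up all the way to \<open>w\<close>.\<close>

lemma recede:
  assumes "a \<in> X" "w \<in> X" "adj x y" "gdist w x = Suc (gdist w y)" "gdist a y = Suc (gdist a x)"
  shows "gdist a w = gdist a x + gdist w x"
  using assms(3-)
proof (induction "gdist w y" arbitrary: x y)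
  case 0
  then have "y = w" using gdist_eq_0 assms adj_in by metis
  with 0 show ?case by simp
next
  case (Suc n)
  have yX: "y \<in> X" using Suc adj_in by blast
  have "y \<noteq> w" using Suc.hyps(2) by auto
  obtain z where z: "adj y z" "gdist w y = Suc (gdist w z)"
    by (rule step_towards[OF yX assms(2) \<open>y \<noteq> w\<close>])
  have "x \<noteq> z" using z Suc by auto
  then have "gdist a z = Suc (gdist a y)"
    using other_neighbour_farther[OF assms(1), of y x z] Suc.prems z adj_sym by auto
  then have "gdist a w = gdist a y + gdist w y"
    using Suc.hyps(1)[of z y] Suc.hyps(2) z by simp
  then show ?case using Suc.prems by simp
qed

text \<open>The dichotomy behind both medians and centres: one step towards \<open>w\<close> either
  approaches \<open>a\<close>, or it shows that \<open>x\<close> lies on the geodesic from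
  \<open>a\<close> to \<open>w\<close>.\<close>

lemma step_towards_or_recede:
  assumes "a \<in> X" "w \<in> X" "adj x y" "gdist w x = Suc (gdist w y)"
  shows "gdist a x = Suc (gdist a y) \<or>
    gdist a y = Suc (gdist a x) \<and> gdist a w = gdist a x + gdist w x"
proof -
  have "gdist a x \<noteq> gdist a y" by (rule adj_gdist_neq[OF assms(1,3)])
  moreover have "gdist a y \<le> Suc (gdist a x)" "gdist a x \<le> Suc (gdist a y)"
    using gdist_adj_step assms adj_sym by auto
  ultimately consider "gdist a x = Suc (gdist a y)" | "gdist a y = Suc (gdist a x)" by linarith
  then show ?thesis using recede[OF assms] by cases auto
qed

section \<open>Geodesics and medians\<close>

definition between :: "'v \<Rightarrow> 'v \<Rightarrow> 'v \<Rightarrow> bool" where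
  "between p m q \<longleftrightarrow> m \<in> X \<and> gdist p m + gdist m q = gdist p q"

lemma between_towards_end:
  assumes "p \<in> X" "q \<in> X" "between p m q" "adj m y" "gdist p m = Suc (gdist p y)"
  shows "between p y q"
proof -
  have X: "m \<in> X" "y \<in> X" using assms adj_in by (auto simp: between_def)
  have "gdist y q \<le> Suc (gdist m q)"
    using gdist_adj_step[OF assms(2,4)] X assms gdist_sym by metis
  moreover have "gdist p q \<le> gdist p y + gdist y q" using gdist_triangle X assms by auto
  ultimately show ?thesis using assms X unfolding between_def by linarith
qed

lemma between_sym: "p \<in> X \<Longrightarrow> q \<in> X \<Longrightarrow> between p m q \<longleftrightarrow> between q m p"
  unfolding between_def using gdist_sym by (metis add.commute)

text \<open>The median is the vertex of the geodesic from \<open>p\<close> to \<open>q\<close>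
  nearest to \<open>r\<close>. A step from it towards \<open>p\<close> or \<open>q\<close> stays on
  that geodesic, so it cannot approach \<open>r\<close> and must recede from it.\<close>

lemma median:
  assumes X: "p \<in> X" "q \<in> X" "r \<in> X"
  obtains m where "between p m q" "between p m r" "between q m r"
proof -
  have "between p p q" using X by (simp add: between_def)
  then obtain m where m: "between p m q" and min: "\<And>y. between p y q \<Longrightarrow> gdist r m \<le> gdist r y"
    using ex_has_least_nat[of "\<lambda>y. between p y q" p "gdist r"] by blast
  have mX: "m \<in> X" using m by (simp add: between_def)
  \<comment> \<open>Stated for a general end \<open>a\<close>, to be used for both \<open>p\<close>
    and \<open>q\<close>.\<close>
  have *: "between a m r" if a: "a \<in> X"
    and step: "\<And>y. adj m y \<Longrightarrow> gdist a m = Suc (gdist a y) \<Longrightarrow> between p y q" for a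
  proof (cases "m = a")
    case True
    then show ?thesis using a by (simp add: between_def)
  next
    case False
    obtain y where y: "adj m y" "gdist a m = Suc (gdist a y)"
      by (rule step_towards[OF mX a False])
    then have "gdist r m \<le> gdist r y" using step min by blast
    then have "gdist r a = gdist r m + gdist a m"
      using step_towards_or_recede[OF X(3) a y] by auto
    then show ?thesis using mX a X gdist_sym unfolding between_def by (metis add.commute)
  qed
  have "between p m r"
    by (rule *[OF X(1)]) (rule between_towards_end[OF X(1,2) m])
  moreover have "between q m r"
  proof (rule *[OF X(2)])
    fix y assume "adj m y" "gdist q m = Suc (gdist q y)"
    then have "between q y p"
      by (rule between_towards_end[OF X(2,1) m[unfolded between_sym[OF X(1,2)]]])
    then show "between p y q" using between_sym[OF X(1,2)] by simp
  qed
  ultimately show thesis using m that by blast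
qed

section \<open>Eccentricity and centres of finite sets\<close>

definition ecc :: "'v set \<Rightarrow> 'v \<Rightarrow> nat" where
  "ecc A x = Max ((\<lambda>a. gdist a x) ` A)"

text \<open>Eccentricity is convex along geodesics: if two minimisers were at distance at least two,
  the first step from one to the other would have smaller eccentricity.\<close>

lemma centres_adjacent:
  assumes A: "finite A" "A \<noteq> {}" "A \<subseteq> X" and X: "u \<in> X" "w \<in> X" "u \<noteq> w"
    and min: "\<And>x. x \<in> X \<Longrightarrow> ecc A u \<le> ecc A x" and eq: "ecc A w = ecc A u"
  shows "adj u w"
proof (rule ccontr)
  assume nadj: "\<not> adj u w"
  obtain y where y: "adj u y" "gdist w u = Suc (gdist w y)"
    by (rule step_towards[OF X])
  have yX: "y \<in> X" using y adj_in by blast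
  have "y \<noteq> w" using y nadj by auto
  \<comment> \<open>A point \<open>a\<close> of \<open>A\<close> farthest from \<open>y\<close>; it
    is enough to see that \<open>u\<close> or \<open>w\<close> is farther from \<open>a\<close> than
    \<open>y\<close> is.\<close>
  have "ecc A y \<in> (\<lambda>a. gdist a y) ` A" unfolding ecc_def using A by (intro Max_in) auto
  then obtain a where a: "a \<in> A" "ecc A y = gdist a y" by auto
  have ecc: "gdist a z \<le> ecc A z" for z unfolding ecc_def using A a by (intro Max_ge) auto
  have aX: "a \<in> X" using a A by blast
  from step_towards_or_recede[OF aX X(2) y] have "gdist a y < ecc A u"
  proof
    assume "gdist a u = Suc (gdist a y)"
    then show ?thesis using ecc[of u] by linarith
  next
    assume *: "gdist a y = Suc (gdist a u) \<and> gdist a w = gdist a u + gdist w u"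
    \<comment> \<open>Non-adjacency enters here: some distance from \<open>y\<close> to
      \<open>w\<close> remains, so \<open>w\<close> is strictly farther from \<open>a\<close> than
      \<open>y\<close>.\<close>
    have "gdist w y \<noteq> 0" using gdist_eq_0 yX X \<open>y \<noteq> w\<close> by metis
    then show ?thesis using * y(2) ecc[of w] eq by linarith
  qed
  with a min[OF yX] show False by simp
qed

end

section \<open>Fixed vertices of tree actions\<close>

context simplicial_tree_action
begin

lemma act_in: "g \<in> carrier G \<Longrightarrow> x \<in> X \<Longrightarrow> \<phi> g x \<in> X"
  using element_image by blast

lemma act_adj: "g \<in> carrier G \<Longrightarrow> adj x y \<Longrightarrow> adj (\<phi> g x) (\<phi> g y)"
  using simplicial[of g "{x, y}"] by simp

lemma act_relpowp: "g \<in> carrier G \<Longrightarrow> (adj ^^ n) x y \<Longrightarrow> (adj ^^ n) (\<phi> g x) (\<phi> g y)"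
  by (induction n arbitrary: y) (auto intro: act_adj)

lemma act_gdist_le:
  "g \<in> carrier G \<Longrightarrow> x \<in> X \<Longrightarrow> y \<in> X \<Longrightarrow> gdist (\<phi> g x) (\<phi> g y) \<le> gdist x y"
  by (simp add: act_relpowp gdist_le gdist_path)

lemma act_gdist:
  assumes "g \<in> carrier G" "x \<in> X" "y \<in> X"
  shows "gdist (\<phi> g x) (\<phi> g y) = gdist x y"
proof -
  interpret group G using group_hom group_hom.axioms(1) by auto
  have "gdist (\<phi> (inv g) (\<phi> g x)) (\<phi> (inv g) (\<phi> g y)) \<le> gdist (\<phi> g x) (\<phi> g y)"
    using assms by (intro act_gdist_le act_in) auto
  then show ?thesis
    using act_gdist_le[OF assms] orbit_sym_aux[OF assms(1)] assms by auto
qed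

text \<open>Induction outwards from \<open>p\<close>: the vertex \<open>y\<close> before
  \<open>m\<close> is fixed, so \<open>m\<close> and its image are both neighbours of
  \<open>y\<close> closer to \<open>q\<close>, and such a neighbour is unique.\<close>

lemma fix_between:
  assumes g: "g \<in> carrier G" and X: "p \<in> X" "q \<in> X" and fx: "\<phi> g p = p" "\<phi> g q = q"
    and m: "between p m q"
  shows "\<phi> g m = m"
  using m
proof (induction "gdist p m" arbitrary: m rule: less_induct)
  case less
  have mX: "m \<in> X" using less.prems by (simp add: between_def)
  show ?case
  proof (cases "m = p")
    case True
    then show ?thesis using fx by simp
  next
    case False
    obtain y where y: "adj m y" "gdist p m = Suc (gdist p y)"
      by (rule step_towards[OF mX X(1) False])
    have b: "between p y q" using between_towards_end X less.prems y by blast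
    then have fy: "\<phi> g y = y" using less.hyps y by simp
    have yX: "y \<in> X" using y adj_in by blast
    have "adj y (\<phi> g m)" using act_adj[OF g y(1)] fy adj_sym by metis
    moreover have "gdist q (\<phi> g m) = gdist q m"
      using act_gdist[OF g X(2) mX] fx by simp
    moreover have "gdist q m \<le> gdist q y"
      using b less.prems y(2) gdist_sym[OF X(2) mX] gdist_sym[OF X(2) yX]
      unfolding between_def by linarith
    ultimately show ?thesis
      using closer_neighbour_unique[OF X(2), of y "\<phi> g m" m] y(1) adj_sym by metis
  qed
qed

text \<open>Closure under products makes each element map the finite set \<open>A\<close> into
  itself, injectively and hence onto. So eccentricity is invariant and \<open>H\<close> permutes the
  at most two centres of \<open>A\<close>.\<close>

lemma fixed_vertex_of_finite:
  assumes H: "finite H" "H \<noteq> {}" "H \<subseteq> carrier G"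
    and closed: "\<And>g h. g \<in> H \<Longrightarrow> h \<in> H \<Longrightarrow> g \<otimes> h \<in> H"
  obtains v where "v \<in> X" "\<forall>h\<in>H. \<phi> h v = v"
proof -
  obtain v0 where v0: "v0 \<in> X" using nonempty by blast
  define A where "A = (\<lambda>h. \<phi> h v0) ` H"
  have A: "finite A" "A \<noteq> {}" "A \<subseteq> X" using H v0 act_in by (auto simp: A_def)
  have inv: "\<phi> h ` A = A" if h: "h \<in> H" for h
  proof -
    have hG: "h \<in> carrier G" using h H by blast
    have "\<phi> h ` A \<subseteq> A"
    proof
      fix x assume "x \<in> \<phi> h ` A"
      then obtain g where g: "g \<in> H" "x = \<phi> h (\<phi> g v0)" by (auto simp: A_def)
      then have "x = \<phi> (h \<otimes> g) v0" using composition_rule[OF v0 hG, of g] H by auto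
      then show "x \<in> A" using closed g h by (auto simp: A_def)
    qed
    moreover have "inj_on (\<phi> h) A" using inj_prop[OF hG] A inj_on_subset by blast
    ultimately show ?thesis using A endo_inj_surj by blast
  qed
  have ecc: "ecc A (\<phi> h x) = ecc A x" if h: "h \<in> H" and x: "x \<in> X" for h x
  proof -
    have hG: "h \<in> carrier G" using h H by blast
    have "(\<lambda>a. gdist a (\<phi> h x)) ` A = (\<lambda>a. gdist a (\<phi> h x)) ` (\<phi> h ` A)" using inv[OF h] by simp
    also have "\<dots> = (\<lambda>a. gdist a x) ` A"
      unfolding image_image using act_gdist[OF hG] A x by (intro image_cong) auto
    finally show ?thesis by (simp add: ecc_def)
  qed
  obtain u where u: "u \<in> X" and min: "\<And>x. x \<in> X \<Longrightarrow> ecc A u \<le> ecc A x"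
    using ex_has_least_nat[of "\<lambda>x. x \<in> X" v0 "ecc A"] v0 by blast
  show thesis
  proof (cases "\<forall>h\<in>H. \<phi> h u = u")
    case True
    with that u show thesis by blast
  next
    case False
    then obtain h where h: "h \<in> H" "\<phi> h u \<noteq> u" by blast
    define w where "w = \<phi> h u"
    have w: "w \<in> X" "ecc A w = ecc A u" "u \<noteq> w"
      using h H u act_in ecc by (auto simp: w_def)
    \<comment> \<open>Three centres would be pairwise adjacent, although adjacent vertices cannot
      both be at distance 1 from \<open>u\<close>.\<close>
    have centre: "x = u \<or> x = w" if x: "x \<in> X" "ecc A x = ecc A u" for x
    proof (rule ccontr)
      assume "\<not> (x = u \<or> x = w)"
      then have "adj u x" "adj u w" "adj w x"
        using centres_adjacent[OF A u x(1)] centres_adjacent[OF A u w(1)]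
          centres_adjacent[OF A w(1) x(1)] x w min by auto
      then show False
        using adj_gdist_neq[OF u, of w x] gdist_adj[of u w] gdist_adj[of u x] by simp
    qed
    have uw: "adj u w" using centres_adjacent[OF A u w(1)] w min by blast
    \<comment> \<open>Each element preserves the edge joining the two centres, so the absence of
      inversions fixes its ends.\<close>
    have "\<phi> g u = u" if g: "g \<in> H" for g
    proof -
      have gG: "g \<in> carrier G" using g H by blast
      have "\<phi> g u \<in> {u, w}" "\<phi> g w \<in> {u, w}"
        using centre[OF act_in[OF gG u]] centre[OF act_in[OF gG w(1)]]
          ecc[OF g u] ecc[OF g w(1)] w(2) by simp_all
      moreover have "\<phi> g u \<noteq> \<phi> g w" using inj_onD[OF inj_prop[OF gG], of u w] u w by blast
      ultimately have "\<phi> g ` {u, w} = {u, w}" by auto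
      then show ?thesis by (rule no_inversions[OF gG uw]) simp
    qed
    with that u show thesis by blast
  qed
qed

end

section \<open>Binary words and dyadic intervals\<close>

abbreviation unit_ivl :: "real set" where
  "unit_ivl \<equiv> {0..<1}"

text \<open>On binary expansions this puts the digits of \<open>u\<close> in front of those of
  \<open>t\<close>.\<close>

primrec cone_map :: "bool list \<Rightarrow> real \<Rightarrow> real" where
  "cone_map [] t = t"
| "cone_map (b # u) t = (of_bool b + cone_map u t) / 2"

text \<open>The cones of the words of length \<open>n\<close> are the standard dyadic intervals of length
  \<open>2\<^sup>-\<^sup>n\<close>.\<close>

abbreviation cone :: "bool list \<Rightarrow> real set" where
  "cone u \<equiv> cone_map u ` unit_ivl"

lemma cone_map_append: "cone_map (u @ v) t = cone_map u (cone_map v t)"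
  by (induction u) auto

lemma cone_map_in: "t \<in> unit_ivl \<Longrightarrow> cone_map u t \<in> unit_ivl"
  by (induction u) auto

lemma cone_map_inj [simp]: "cone_map u s = cone_map u t \<longleftrightarrow> s = t"
  by (induction u) auto

lemma cone_append_subset: "cone (u @ w) \<subseteq> cone u"
  using cone_map_in by (auto simp: cone_map_append)

lemma zero_in_cone: "cone_map u 0 \<in> cone u"
  by simp

lemma cone_disjoint:
  assumes "u \<parallel> v"
  shows "cone u \<inter> cone v = {}"
proof -
  obtain p b u' c v' where *: "b \<noteq> c" "u = p @ b # u'" "v = p @ c # v'"
    using parallel_decomp[OF assms] by blast
  have "cone_map u s \<noteq> cone_map v t" if "s \<in> unit_ivl" "t \<in> unit_ivl" for s t
    using cone_map_in[OF that(1), of u'] cone_map_in[OF that(2), of v'] *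
    by (cases b; cases c) (auto simp: cone_map_append)
  then show ?thesis by auto
qed

lemma cone_cover:
  assumes "x \<in> unit_ivl"
  shows "\<exists>u. length u = n \<and> x \<in> cone u"
  using assms
proof (induction n arbitrary: x)
  case (Suc n)
  define b where "b \<longleftrightarrow> x \<ge> 1/2"
  have "2 * x - of_bool b \<in> unit_ivl" using Suc.prems by (auto simp: b_def)
  from Suc.IH[OF this] obtain u t
    where u: "length u = n" "t \<in> unit_ivl" "2 * x - of_bool b = cone_map u t" by blast
  then have "x = cone_map (b # u) t" by simp
  with u show ?case by (intro exI[of _ "b # u"]) auto
qed auto

text \<open>Otherwise the cones are disjoint, or \<open>v\<close> properly extends \<open>u\<close>;
  then the half of the cone of \<open>u\<close> that branches off from \<open>v\<close> is
  missed.\<close>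

lemma cone_subset_imp_prefix:
  assumes "cone u \<subseteq> cone v"
  shows "prefix v u"
proof (rule ccontr)
  assume np: "\<not> prefix v u"
  have "\<not> u \<parallel> v" using cone_disjoint[of u v] assms zero_in_cone[of u] by blast
  with np have "prefix u v" by (auto simp: parallel_def)
  then obtain z where z: "v = u @ z" by (auto simp: prefix_def)
  with np obtain b w where v: "v = u @ b # w" by (cases z) auto
  have "(u @ [\<not> b]) \<parallel> v" unfolding v by (auto simp: parallel_def)
  then have "cone (u @ [\<not> b]) \<inter> cone v = {}" by (rule cone_disjoint)
  then show False
    using cone_append_subset[of u "[\<not> b]"] zero_in_cone[of "u @ [\<not> b]"] assms by blast
qed

lemma cone_map_affine:
  obtains k where "k < 2 ^ length u" "\<And>t. cone_map u t = (real k + t) / 2 ^ length u"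
proof -
  have "\<exists>k < 2 ^ length u. \<forall>t. cone_map u t = (real k + t) / 2 ^ length u"
  proof (induction u)
    case (Cons b u)
    then obtain k where "k < 2 ^ length u" "\<forall>t. cone_map u t = (real k + t) / 2 ^ length u" by blast
    then show ?case
      by (intro exI[of _ "of_bool b * 2 ^ length u + k"]) (cases b; simp add: field_simps)
  qed auto
  then show thesis using that by blast
qed

text \<open>\<open>u\<close> is the \<open>n\<close>-digit binary notation of \<open>k\<close>; this
  identifies the intervals of length 2^-n between consecutive multiples of 2^-n as cones.\<close>

lemma cone_of_index:
  assumes "k < 2 ^ n"
  shows "\<exists>u. length u = n \<and> (\<forall>t. cone_map u t = (real k + t) / 2 ^ n)"
  using assms
proof (induction n arbitrary: k)
  case (Suc n)
  define b where "b \<longleftrightarrow> k \<ge> 2 ^ n"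
  have "k - of_bool b * 2 ^ n < 2 ^ n" using Suc.prems by (auto simp: b_def)
  from Suc.IH[OF this] obtain u
    where u: "length u = n" "\<forall>t. cone_map u t = (real (k - of_bool b * 2 ^ n) + t) / 2 ^ n" by blast
  have "real (k - of_bool b * 2 ^ n) = real k - of_bool b * 2 ^ n"
    by (cases b) (simp_all add: b_def of_nat_diff)
  then have "\<forall>t. cone_map (b # u) t = (real k + t) / 2 ^ Suc n"
    by (simp add: u(2) add_divide_distrib diff_divide_distrib)
  then show ?case using u(1) by (metis length_Cons)
qed auto

section \<open>Prefix replacement and tables\<close>

definition maps_cone :: "(real \<Rightarrow> real) \<Rightarrow> bool list \<Rightarrow> bool list \<Rightarrow> bool" where
  "maps_cone f u v \<longleftrightarrow> (\<forall>t\<in>unit_ivl. f (cone_map u t) = cone_map v t)"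

lemma maps_coneD: "maps_cone f u v \<Longrightarrow> t \<in> unit_ivl \<Longrightarrow> f (cone_map u t) = cone_map v t"
  by (simp add: maps_cone_def)

lemma maps_cone_append: "maps_cone f u v \<Longrightarrow> maps_cone f (u @ w) (v @ w)"
  using cone_map_in by (simp add: maps_cone_def cone_map_append)

lemma maps_cone_compose:
  "maps_cone f u v \<Longrightarrow> maps_cone g v w \<Longrightarrow> maps_cone (compose unit_ivl g f) u w"
  using cone_map_in by (simp add: maps_cone_def compose_def)

lemma Bij_in: "f \<in> Bij S \<Longrightarrow> x \<in> S \<Longrightarrow> f x \<in> S"
  using Bij_imp_funcset by blast

lemma Bij_eq_iff: "f \<in> Bij S \<Longrightarrow> x \<in> S \<Longrightarrow> y \<in> S \<Longrightarrow> f x = f y \<longleftrightarrow> x = y"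
  by (auto simp: Bij_def bij_betw_def inj_on_def)

text \<open>Injectivity makes the image cones disjoint, whereas comparable words have nested
  cones.\<close>

lemma maps_cone_disjoint:
  assumes f: "f \<in> Bij unit_ivl" and "maps_cone f u u'" "maps_cone f v v'" and uv: "u \<parallel> v"
  shows "u' \<parallel> v'"
proof (rule ccontr)
  assume np: "\<not> u' \<parallel> v'"
  have disj: "cone u' \<inter> cone v' = {}"
  proof -
    have "cone_map u' s \<noteq> cone_map v' t" if "s \<in> unit_ivl" "t \<in> unit_ivl" for s t
    proof -
      have "cone_map u s \<noteq> cone_map v t" using cone_disjoint[OF uv] that by blast
      then have "f (cone_map u s) \<noteq> f (cone_map v t)"
        using Bij_eq_iff[OF f] cone_map_in that by metis
      then show ?thesis using assms that by (simp add: maps_coneD)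
    qed
    then show ?thesis by auto
  qed
  from np consider w where "v' = u' @ w" | w where "u' = v' @ w"
    by (auto simp: parallel_def prefix_def)
  then show False
  proof cases
    case 1
    then show ?thesis using disj cone_append_subset[of u' w] zero_in_cone[of v'] by blast
  next
    case 2
    then show ?thesis using disj cone_append_subset[of v' w] zero_in_cone[of u'] by blast
  qed
qed

text \<open>The table description of elements of V. Any finite table can be refined to source words
  of one length, and with a uniform length the bounds simply add under composition.\<close>

definition tabular :: "(real \<Rightarrow> real) \<Rightarrow> bool" where
  "tabular f \<longleftrightarrow> (\<exists>n. \<forall>u. length u = n \<longrightarrow> (\<exists>v. maps_cone f u v))"

text \<open>The explicit tail \<open>drop n u\<close> bounds the length of the image word from
  below, so that a second table can be applied to it.\<close>

lemma tabular_mono: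
  assumes "\<forall>u. length u = n \<longrightarrow> (\<exists>v. maps_cone f u v)" "n \<le> length u"
  shows "\<exists>v. maps_cone f u (v @ drop n u)"
proof -
  have "length (take n u) = n" using assms(2) by simp
  then obtain v where "maps_cone f (take n u) v" using assms(1) by blast
  from maps_cone_append[OF this, of "drop n u"] show ?thesis by auto
qed

lemma tabular_id: "tabular (\<lambda>x\<in>unit_ivl. x)"
  unfolding tabular_def maps_cone_def using cone_map_in by (metis restrict_apply')

lemma tabular_compose:
  assumes "tabular f" "tabular g"
  shows "tabular (compose unit_ivl g f)"
proof -
  obtain n where n: "\<forall>u. length u = n \<longrightarrow> (\<exists>v. maps_cone f u v)"
    using assms(1) by (auto simp: tabular_def)
  obtain m where m: "\<forall>u. length u = m \<longrightarrow> (\<exists>v. maps_cone g u v)"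
    using assms(2) by (auto simp: tabular_def)
  have "\<exists>v. maps_cone (compose unit_ivl g f) u v" if u: "length u = n + m" for u
  proof -
    obtain v where v: "maps_cone f u (v @ drop n u)"
      using tabular_mono[OF n, of u] u by auto
    have "m \<le> length (v @ drop n u)" using u by simp
    from tabular_mono[OF m this] obtain w where "maps_cone g (v @ drop n u) w" by blast
    with v show ?thesis using maps_cone_compose by blast
  qed
  then show ?thesis unfolding tabular_def by blast
qed

lemma finite_words: "finite {u :: bool list. length u = n}"
  using finite_lists_length_eq[of "UNIV :: bool set" n] by simp

lemma tabular_inverse:
  assumes f: "f \<in> Bij unit_ivl" "tabular f"
    and g: "\<And>x. x \<in> unit_ivl \<Longrightarrow> g (f x) = x"
  shows "tabular g"
proof -
  obtain n where n: "\<forall>u. length u = n \<longrightarrow> (\<exists>v. maps_cone f u v)"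
    using f(2) by (auto simp: tabular_def)
  then obtain V where V: "\<And>u. length u = n \<Longrightarrow> maps_cone f u (V u)" by metis
  \<comment> \<open>No image word is longer than \<open>N\<close>, so a word of length
    \<open>N\<close> whose cone meets that of an image word must extend it.\<close>
  define N where "N = Max ((\<lambda>u. length (V u)) ` {u. length u = n})"
  have N: "length (V u) \<le> N" if "length u = n" for u
    unfolding N_def using that finite_words by (intro Max_ge) auto
  have "\<exists>v. maps_cone g w v" if w: "length w = N" for w
  proof -
    have "cone_map w 0 \<in> f ` unit_ivl"
      using f(1) cone_map_in[of 0 w] by (auto simp: Bij_def bij_betw_def)
    then obtain x where x: "x \<in> unit_ivl" "cone_map w 0 = f x" by blast
    obtain u t where u: "length u = n" "t \<in> unit_ivl" "x = cone_map u t"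
      using cone_cover[OF x(1), of n] by blast
    have "cone_map w 0 = cone_map (V u) t" using x u maps_coneD[OF V] by simp
    then have "cone_map w 0 \<in> cone (V u)" using u(2) by blast
    then have "cone w \<inter> cone (V u) \<noteq> {}" using zero_in_cone[of w] by blast
    then have "\<not> w \<parallel> V u" using cone_disjoint by blast
    then have "prefix (V u) w"
      using N[OF u(1)] w by (auto simp: parallel_def prefix_def)
    then obtain z where z: "w = V u @ z" by (auto simp: prefix_def)
    have "g (cone_map w s) = cone_map (u @ z) s" if s: "s \<in> unit_ivl" for s
      using maps_coneD[OF maps_cone_append[OF V[OF u(1)], of z] s] g[OF cone_map_in[OF s, of "u @ z"]] z
      by simp
    then show ?thesis unfolding maps_cone_def by blast
  qed
  then show ?thesis unfolding tabular_def by blast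
qed

section \<open>Exchanges of two cones\<close>

definition swap :: "bool list \<Rightarrow> bool list \<Rightarrow> real \<Rightarrow> real" where
  "swap u v = (\<lambda>x\<in>unit_ivl.
     if x \<in> cone u then cone_map v (the_inv_into unit_ivl (cone_map u) x)
     else if x \<in> cone v then cone_map u (the_inv_into unit_ivl (cone_map v) x)
     else x)"

lemma inj_on_cone_map: "inj_on (cone_map u) A"
  by (simp add: inj_on_def)

lemma swap_maps_left: "maps_cone (swap u v) u v"
  unfolding maps_cone_def swap_def using cone_map_in
  by (auto simp: the_inv_into_f_f[OF inj_on_cone_map])

lemma swap_maps_right: "u \<parallel> v \<Longrightarrow> maps_cone (swap u v) v u"
  unfolding maps_cone_def swap_def using cone_map_in cone_disjoint[of u v]
  by (auto simp: the_inv_into_f_f[OF inj_on_cone_map] simp del: atLeastLessThan_iff)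

lemma swap_outside: "x \<in> unit_ivl \<Longrightarrow> x \<notin> cone u \<Longrightarrow> x \<notin> cone v \<Longrightarrow> swap u v x = x"
  by (simp add: swap_def)

lemma swap_maps_outside:
  assumes "w \<parallel> u" "w \<parallel> v"
  shows "maps_cone (swap u v) w w"
  unfolding maps_cone_def
proof
  fix t assume t: "t \<in> unit_ivl"
  then have "cone_map w t \<in> cone w" by blast
  then show "swap u v (cone_map w t) = cone_map w t"
    using cone_disjoint[OF assms(1)] cone_disjoint[OF assms(2)] cone_map_in[OF t]
    by (intro swap_outside) blast+
qed

lemma swap_swap_in:
  assumes "u \<parallel> v" "x \<in> unit_ivl"
  shows "swap u v x \<in> unit_ivl \<and> swap u v (swap u v x) = x"
proof -
  consider t where "t \<in> unit_ivl" "x = cone_map u t" | t where "t \<in> unit_ivl" "x = cone_map v t"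
    | "x \<notin> cone u" "x \<notin> cone v" by blast
  then show ?thesis
  proof cases
    case 1
    then show ?thesis
      using maps_coneD[OF swap_maps_left 1(1)] maps_coneD[OF swap_maps_right[OF assms(1)] 1(1)]
        cone_map_in[OF 1(1)] by metis
  next
    case 2
    then show ?thesis
      using maps_coneD[OF swap_maps_left 2(1)] maps_coneD[OF swap_maps_right[OF assms(1)] 2(1)]
        cone_map_in[OF 2(1)] by metis
  next
    case 3
    then show ?thesis using swap_outside assms(2) by metis
  qed
qed

lemmas swap_in = swap_swap_in[THEN conjunct1]
lemmas swap_swap = swap_swap_in[THEN conjunct2]

lemma swap_Bij:
  assumes "u \<parallel> v"
  shows "swap u v \<in> Bij unit_ivl"
proof -
  have "bij_betw (swap u v) unit_ivl unit_ivl"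
    using swap_in[OF assms] swap_swap[OF assms]
    by (intro bij_betw_byWitness[where f' = "swap u v"]) blast+
  then show ?thesis by (simp add: Bij_def swap_def)
qed

text \<open>The action of \<^term>\<open>swap p q\<close> on words; it is meaningful on words
  which are not proper prefixes of \<^term>\<open>p\<close> or \<^term>\<open>q\<close>.\<close>

definition swap_word :: "bool list \<Rightarrow> bool list \<Rightarrow> bool list \<Rightarrow> bool list" where
  "swap_word p q w = (if prefix p w then q @ drop (length p) w
     else if prefix q w then p @ drop (length q) w else w)"

lemma swap_maps_word:
  assumes "p \<parallel> q" "\<not> strict_prefix w p" "\<not> strict_prefix w q"
  shows "maps_cone (swap p q) w (swap_word p q w)"
proof -
  consider z where "w = p @ z" | z where "w = q @ z" "\<not> prefix p w" | "w \<parallel> p" "w \<parallel> q"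
    using assms(2,3) unfolding parallel_def strict_prefix_def by (metis prefixE prefix_order.refl)
  then show ?thesis
  proof cases
    case 1
    then show ?thesis using maps_cone_append[OF swap_maps_left] by (simp add: swap_word_def)
  next
    case 2
    then show ?thesis
      using maps_cone_append[OF swap_maps_right[OF assms(1)]] by (simp add: swap_word_def)
  next
    case 3
    then have "swap_word p q w = w" by (auto simp: swap_word_def parallel_def)
    with swap_maps_outside[OF 3] show ?thesis by simp
  qed
qed

lemma swap_tabular:
  assumes "u \<parallel> v"
  shows "tabular (swap u v)"
proof -
  have "\<exists>w'. maps_cone (swap u v) w w'" if "length w = length u + length v" for w
  proof -
    have "\<not> strict_prefix w u" "\<not> strict_prefix w v"
      using that prefix_length_less[of w] by fastforce+
    then show ?thesis using swap_maps_word[OF assms] by blast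
  qed
  then show ?thesis unfolding tabular_def by blast
qed

text \<open>As \<open>swap p q\<close> is an involution, the conjugate goes from the cone of
  \<open>u'\<close> back to that of \<open>u\<close>, across to \<open>v\<close>, and forward to
  \<open>v'\<close>; outside both target cones the outer maps cancel.\<close>

lemma swap_conj:
  assumes pq: "p \<parallel> q" and uv: "u \<parallel> v"
    and u: "maps_cone (swap p q) u u'" and v: "maps_cone (swap p q) v v'"
  shows "compose unit_ivl (swap p q) (compose unit_ivl (swap u v) (swap p q)) = swap u' v'"
proof
  fix x
  let ?s = "swap p q"
  have uv': "u' \<parallel> v'" using maps_cone_disjoint[OF swap_Bij[OF pq] u v uv] .
  show "compose unit_ivl ?s (compose unit_ivl (swap u v) ?s) x = swap u' v' x"
  proof (cases "x \<in> unit_ivl")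
    case False
    then show ?thesis by (simp only: compose_def swap_def restrict_apply if_False)
  next
    case True
    define y where "y = ?s x"
    have y: "y \<in> unit_ivl" "?s y = x" using swap_in[OF pq] swap_swap[OF pq] True by (auto simp: y_def)
    have lhs: "compose unit_ivl ?s (compose unit_ivl (swap u v) ?s) x = ?s (swap u v y)"
      using True by (simp add: compose_def y_def)
    consider t where "t \<in> unit_ivl" "y = cone_map u t" | t where "t \<in> unit_ivl" "y = cone_map v t"
      | "y \<notin> cone u" "y \<notin> cone v" by blast
    then show ?thesis
    proof cases
      case 1
      then have "x = cone_map u' t" using u y by (metis maps_coneD)
      then show ?thesis
        using lhs 1 v maps_coneD[OF swap_maps_left] by (simp add: maps_coneD)
    next
      case 2
      then have "x = cone_map v' t" using v y by (metis maps_coneD)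
      then show ?thesis
        using lhs 2 u maps_coneD[OF swap_maps_right] uv uv' by (simp add: maps_coneD)
    next
      case 3
      have "x \<notin> cone u'"
      proof
        assume "x \<in> cone u'"
        then obtain t where t: "t \<in> unit_ivl" "x = cone_map u' t" by blast
        then have "x = ?s (cone_map u t)" using u by (simp add: maps_coneD)
        then have "y = cone_map u t" using swap_swap[OF pq] cone_map_in[OF t(1)] by (simp add: y_def)
        with 3 t show False by blast
      qed
      moreover have "x \<notin> cone v'"
      proof
        assume "x \<in> cone v'"
        then obtain t where t: "t \<in> unit_ivl" "x = cone_map v' t" by blast
        then have "x = ?s (cone_map v t)" using v by (simp add: maps_coneD)
        then have "y = cone_map v t" using swap_swap[OF pq] cone_map_in[OF t(1)] by (simp add: y_def)
        with 3 t show False by blast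
      qed
      ultimately show ?thesis using lhs 3 y True by (simp add: swap_outside)
    qed
  qed
qed

section \<open>Elements of V as maps of dyadic intervals\<close>

lemma dyadics_real_iff: "(x :: real) \<in> dyadics \<longleftrightarrow> (\<exists>m n. x = real m / 2 ^ n)"
  by (auto simp: dyadics_def)

lemma dyadic_common_denominator:
  assumes "finite B" "B \<subseteq> (dyadics :: real set)"
  shows "\<exists>n. \<forall>b\<in>B. \<exists>m. b = real m / 2 ^ n"
  using assms
proof (induction B rule: finite_induct)
  case (insert x B)
  then obtain n where n: "\<forall>b\<in>B. \<exists>m. b = real m / 2 ^ n" by auto
  obtain m l where x: "x = real m / 2 ^ l" using insert by (auto simp: dyadics_real_iff)
  have "\<exists>j. b = real j / 2 ^ (n + l)" if "b \<in> insert x B" for b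
  proof (cases "b = x")
    case True
    then have "b = real (m * 2 ^ n) / 2 ^ (n + l)" by (simp add: x power_add)
    then show ?thesis ..
  next
    case False
    then have "b \<in> B" using that by simp
    then obtain j where "b = real j / 2 ^ n" using n by blast
    then have "b = real (j * 2 ^ l) / 2 ^ (n + l)" by (simp add: power_add)
    then show ?thesis ..
  qed
  then show ?case by blast
qed auto

lemma powi_div_power:
  assumes "int L = int N - i"
  shows "(2::real) powi i / 2 ^ N = 1 / 2 ^ L"
proof -
  have "(2::real) powi i = 2 powi (int N - int L)" using assms by (intro arg_cong[where f = "(powi) 2"]) linarith
  also have "\<dots> = 2 ^ N / 2 ^ L" by (simp add: power_int_diff)
  finally show ?thesis by simp
qed

text \<open>A subcone of depth \<open>m\<close> has an image of length 2^-L with L = n + m - i, and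
  for large \<open>m\<close> its left end is a multiple of that length. The bound \<open>M\<close>
  covers all larger depths, so that finitely many cones can later share one depth.\<close>

lemma affine_maps_small_cones:
  assumes f: "f \<in> Bij unit_ivl"
    and aff: "\<And>t. t \<in> unit_ivl \<Longrightarrow> f (cone_map u t) = 2 powi i * cone_map u t + c"
    and dy: "f (cone_map u 0) \<in> dyadics"
  shows "\<exists>M. \<forall>m\<ge>M. \<forall>w. length w = m \<longrightarrow> (\<exists>v. maps_cone f (u @ w) v)"
proof -
  obtain j l where jl: "f (cone_map u 0) = real j / 2 ^ l" using dy by (auto simp: dyadics_real_iff)
  define n where "n = length u"
  obtain k where k: "\<And>t. cone_map u t = (real k + t) / 2 ^ n"
    using cone_map_affine[of u] unfolding n_def by metis
  have f_eq: "f (cone_map u t) = real j / 2 ^ l + 2 powi i * t / 2 ^ n" if "t \<in> unit_ivl" for t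
  proof -
    have "f (cone_map u t) - f (cone_map u 0) = 2 powi i * (cone_map u t - cone_map u 0)"
      using aff[OF that] aff[of 0] by (simp add: algebra_simps)
    also have "cone_map u t - cone_map u 0 = t / 2 ^ n" by (simp add: k add_divide_distrib)
    finally show ?thesis unfolding jl by simp
  qed
  have "\<exists>v. maps_cone f (u @ w) v" if w: "length w \<ge> l + nat \<bar>i\<bar>" for w
  proof -
    define m where "m = length w"
    \<comment> \<open>The bound on \<open>m\<close> makes the integer nonnegative, so
      \<open>nat\<close> loses nothing, and at least \<open>l\<close>, so j / 2^l has denominator
      \<open>2 ^ L\<close>.\<close>
    define L where "L = nat (int (n + m) - i)"
    have L: "int L = int (n + m) - i" "l \<le> L" using w by (auto simp: L_def m_def)
    obtain p where p: "\<And>t. cone_map w t = (real p + t) / 2 ^ m"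
      using cone_map_affine[of w] unfolding m_def by metis
    define q where "q = j * 2 ^ (L - l) + p"
    have "(2::real) ^ L = 2 ^ l * 2 ^ (L - l)" using L(2) by (simp flip: power_add)
    then have jL: "real j / 2 ^ l = real (j * 2 ^ (L - l)) / 2 ^ L" by simp
    have eq: "f (cone_map (u @ w) t) = (real q + t) / 2 ^ L" if t: "t \<in> unit_ivl" for t
    proof -
      have "f (cone_map (u @ w) t) = real j / 2 ^ l + 2 powi i * ((real p + t) / 2 ^ m) / 2 ^ n"
        using f_eq[OF cone_map_in[OF t, of w]] by (simp add: cone_map_append p)
      also have "2 powi i * ((real p + t) / 2 ^ m) / 2 ^ n = (real p + t) * (2 powi i / 2 ^ (n + m))"
        by (simp add: power_add mult.commute)
      also have "2 powi i / 2 ^ (n + m) = 1 / (2::real) ^ L" by (rule powi_div_power[OF L(1)])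
      finally show ?thesis by (simp add: jL q_def add_divide_distrib)
    qed
    \<comment> \<open>The image stays in the unit interval, which bounds \<open>q\<close> and makes
      it the index of a cone.\<close>
    have "f (cone_map (u @ w) 0) \<in> unit_ivl"
      using Bij_in[OF f] cone_map_in[of 0] by simp
    then have "real q < 2 ^ L" using eq[of 0] by (simp add: field_simps)
    then have "q < 2 ^ L" by (metis of_nat_less_iff of_nat_numeral of_nat_power)
    from cone_of_index[OF this] obtain v where "\<forall>t. cone_map v t = (real q + t) / 2 ^ L" by blast
    then have "maps_cone f (u @ w) v" using eq by (simp add: maps_cone_def)
    then show ?thesis ..
  qed
  then show ?thesis by blast
qed

text \<open>Choose \<open>n\<close> so that all break points are multiples of 2^-n; then
  \<open>f\<close> is affine on every cone of depth \<open>n\<close>, and deeper cones inside it go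
  to cones.\<close>

lemma thompson_V_set_tabular:
  assumes f: "f \<in> thompson_V_set"
  shows "tabular f"
proof -
  note V = f[unfolded thompson_V_set_def mem_Collect_eq]
  have fB: "f \<in> Bij unit_ivl" using V by blast
  have "\<exists>n. \<forall>b\<in>unit_ivl - diff_points f. \<exists>m. b = real m / 2 ^ n"
    using V by (intro dyadic_common_denominator) blast+
  then obtain n where n: "\<And>b. b \<in> unit_ivl - diff_points f \<Longrightarrow> \<exists>m. b = real m / 2 ^ n"
    by blast
  have "\<exists>M. \<forall>m\<ge>M. \<forall>w. length w = m \<longrightarrow> (\<exists>v. maps_cone f (u @ w) v)" if u: "length u = n" for u
  proof -
    obtain k where k: "\<And>t. cone_map u t = (real k + t) / 2 ^ n"
      using cone_map_affine[of u] u by metis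
    \<comment> \<open>Only the interior: the left end point of the cone may itself be a break
      point.\<close>
    let ?J = "cone_map u ` {0<..<1}"
    have J: "?J = {cone_map u 0<..<cone_map u 1}"
    proof (intro equalityI subsetI)
      fix x assume "x \<in> {cone_map u 0<..<cone_map u 1}"
      then have "x = cone_map u (2 ^ n * x - k)" "2 ^ n * x - k \<in> {0<..<1}"
        by (auto simp: k field_simps)
      then show "x \<in> ?J" by blast
    qed (auto simp: k field_simps)
    have "?J \<subseteq> diff_points f"
    proof
      fix x assume "x \<in> ?J"
      then obtain t where t: "0 < t" "t < 1" "x = cone_map u t" by auto
      show "x \<in> diff_points f"
      proof (rule ccontr)
        assume "x \<notin> diff_points f"
        moreover have "x \<in> unit_ivl" using cone_map_in[of t u] t by simp
        ultimately obtain m where "x = real m / 2 ^ n" using n by blast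
        then have "real m = real k + t" using t by (simp add: k)
        then have "real k < real m" "real m < real (k + 1)" using t by auto
        then have "k < m" "m < k + 1" by (simp_all only: of_nat_less_iff)
        then show False by simp
      qed
    qed
    moreover have "connected ?J" unfolding J by simp
    moreover have "?J \<noteq> {}" by simp
    ultimately obtain C where C: "C \<in> components (diff_points f)" "?J \<subseteq> C"
      using exists_component_superset[of ?J "diff_points f"] by blast
    then obtain i c where ic: "\<forall>x\<in>C. f x = 2 powi (i::int) * x + c" using V by blast
    let ?a = "cone_map u 0"
    have aI: "?a \<in> unit_ivl" using cone_map_in[of 0 u] by simp
    \<comment> \<open>Right continuity extends the formula to the left end: two limits from the
      right must agree.\<close>
    have "(f \<longlongrightarrow> f ?a) (at_right ?a)"
      using V aI by (simp add: continuous_within)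
    moreover have "(f \<longlongrightarrow> 2 powi i * ?a + c) (at_right ?a)"
    proof (rule tendsto_cong[THEN iffD2])
      have "\<forall>\<^sub>F x in at_right ?a. x \<in> {?a<..<cone_map u 1}"
        by (rule eventually_at_right_real) (simp add: k field_simps)
      then show "\<forall>\<^sub>F x in at_right ?a. f x = 2 powi i * x + c"
        by (rule eventually_mono) (use ic C(2) J in blast)
    qed (auto intro!: tendsto_intros)
    ultimately have fa: "f ?a = 2 powi i * ?a + c"
      using tendsto_unique trivial_limit_at_right_real by blast
    have "f (cone_map u t) = 2 powi i * cone_map u t + c" if t: "t \<in> unit_ivl" for t
    proof (cases "t = 0")
      case False
      then have "cone_map u t \<in> ?J" using t by auto
      then show ?thesis using ic C(2) by blast
    qed (simp add: fa)
    moreover have "?a \<in> dyadics" unfolding dyadics_real_iff k by (intro exI[of _ k] exI[of _ n]) simp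
    then have "f ?a \<in> dyadics" using V aI by blast
    ultimately show ?thesis using affine_maps_small_cones[OF fB] by blast
  qed
  then obtain M where M: "\<And>u m w. length u = n \<Longrightarrow> m \<ge> M u \<Longrightarrow> length w = m
      \<Longrightarrow> \<exists>v. maps_cone f (u @ w) v" by metis
  define N where "N = Max (M ` {u. length u = n})"
  have N: "M u \<le> N" if "length u = n" for u
    unfolding N_def using that finite_words by (intro Max_ge) auto
  have "\<exists>v. maps_cone f x v" if "length x = n + N" for x
    using M[of "take n x" N "drop n x"] N[of "take n x"] that by simp
  then show ?thesis unfolding tabular_def by blast
qed

text \<open>Both one-sided difference quotients tend to the derivative, so the slopes agree;
  continuity at \<open>a\<close> then matches the constants.\<close>

lemma affine_pieces_agree:
  fixes f :: "real \<Rightarrow> real"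
  assumes d: "f differentiable (at a)" and lr: "l < a" "a < r"
    and left: "\<And>x. x \<in> {l<..<a} \<Longrightarrow> f x = s * x + c"
    and right: "\<And>x. x \<in> {a..<r} \<Longrightarrow> f x = s' * x + c'"
  shows "s = s' \<and> c = c'"
proof -
  have evl: "\<forall>\<^sub>F x in at_left a. x \<in> {l<..<a}" by (rule eventually_at_left_real[OF lr(1)])
  have evr: "\<forall>\<^sub>F x in at_right a. x \<in> {a<..<r}" by (rule eventually_at_right_real[OF lr(2)])
  have fa: "f a = s' * a + c'" using right lr by simp
  have "isCont f a" using d by (simp add: differentiable_imp_continuous_within)
  then have "(f \<longlongrightarrow> f a) (at_left a)" by (metis continuous_at_imp_continuous_within continuous_within)
  moreover have "(f \<longlongrightarrow> s * a + c) (at_left a)"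
  proof (rule tendsto_cong[THEN iffD2])
    show "\<forall>\<^sub>F x in at_left a. f x = s * x + c" using evl by (rule eventually_mono) (rule left)
  qed (auto intro!: tendsto_intros)
  ultimately have fa': "f a = s * a + c"
    using tendsto_unique trivial_limit_at_left_real by blast
  obtain D where "(f has_field_derivative D) (at a)" using d real_differentiable_def by blast
  then have D: "((\<lambda>y. (f y - f a) / (y - a)) \<longlongrightarrow> D) (at a)"
    by (simp add: has_field_derivative_iff)
  have "((\<lambda>y. (f y - f a) / (y - a)) \<longlongrightarrow> D) (at_left a)"
    by (rule tendsto_within_subset[OF D]) simp
  moreover have "((\<lambda>y. (f y - f a) / (y - a)) \<longlongrightarrow> s) (at_left a)"
  proof (rule tendsto_eventually, rule eventually_mono[OF evl])
    fix y assume "y \<in> {l<..<a}"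
    then show "(f y - f a) / (y - a) = s" using left[of y] fa'
      by (simp add: divide_eq_eq) (simp add: algebra_simps)
  qed
  ultimately have 1: "D = s" using tendsto_unique trivial_limit_at_left_real by blast
  have "((\<lambda>y. (f y - f a) / (y - a)) \<longlongrightarrow> D) (at_right a)"
    by (rule tendsto_within_subset[OF D]) simp
  moreover have "((\<lambda>y. (f y - f a) / (y - a)) \<longlongrightarrow> s') (at_right a)"
  proof (rule tendsto_eventually, rule eventually_mono[OF evr])
    fix y assume "y \<in> {a<..<r}"
    then show "(f y - f a) / (y - a) = s'" using right[of y] fa
      by (simp add: divide_eq_eq) (simp add: algebra_simps)
  qed
  ultimately have "D = s'" using tendsto_unique trivial_limit_at_right_real by blast
  with 1 fa fa' show ?thesis by auto
qed

text \<open>The delicate part is the last condition, since a component of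
  \<open>diff_points f\<close> may cross several cones. Slope and constant are shown to be locally
  constant on the component, hence constant by connectedness.\<close>

lemma tabular_thompson_V_set:
  assumes f: "f \<in> Bij unit_ivl" "tabular f"
  shows "f \<in> thompson_V_set"
proof -
  obtain n where n: "\<forall>u. length u = n \<longrightarrow> (\<exists>v. maps_cone f u v)"
    using f(2) by (auto simp: tabular_def)
  let ?N = "(2::real) ^ n"
  \<comment> \<open>Row \<open>k\<close> of the table in coordinates: the \<open>k\<close>-th
    interval of depth \<open>n\<close> goes to the \<open>j\<close>-th one of depth
    \<open>L\<close>.\<close>
  define P where "P k j L \<longleftrightarrow>
    (\<forall>x\<in>{real k / ?N..<(real k + 1) / ?N}. f x = (real j + (?N * x - k)) / 2 ^ L)" for k j L :: nat
  have "\<exists>j L. P k j L"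
    if k: "k < 2 ^ n" for k :: nat
  proof -
    obtain u where u: "length u = n" "\<forall>t. cone_map u t = (real k + t) / 2 ^ n"
      using cone_of_index[OF k] by blast
    obtain v where v: "maps_cone f u v" using n u by blast
    obtain j where j: "\<And>t. cone_map v t = (real j + t) / 2 ^ length v"
      using cone_map_affine[of v] by metis
    have "f x = (real j + (?N * x - k)) / 2 ^ length v" if "x \<in> {real k / ?N..<(real k + 1) / ?N}" for x
    proof -
      have "?N * x - k \<in> unit_ivl" using that by (auto simp: field_simps)
      from maps_coneD[OF v this] show ?thesis using u(2) j by simp
    qed
    then show ?thesis unfolding P_def by blast
  qed
  then obtain j L where "\<And>k. k < 2 ^ n \<Longrightarrow> P k (j k) (L k)"
    by metis
  then have jL: "f x = (real (j k) + (?N * x - k)) / 2 ^ L k"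
    if "k < 2 ^ n" "x \<in> {real k / ?N..<(real k + 1) / ?N}" for k x
    using that unfolding P_def by blast
  define s where "s k = (2::real) powi (int n - int (L k))" for k
  define c where "c k = (real (j k) - real k) / 2 ^ L k" for k
  have aff: "f x = s k * x + c k" if "k < 2 ^ n" "x \<in> {real k / ?N..<(real k + 1) / ?N}" for k x
    unfolding jL[OF that] s_def c_def
    by (simp add: power_int_diff add_divide_distrib diff_divide_distrib)
  define ix where "ix x = nat \<lfloor>?N * x\<rfloor>" for x :: real
  have ix_eq: "ix x = k" if "x \<in> {real k / ?N..<(real k + 1) / ?N}" for x k
  proof -
    have "real k \<le> ?N * x" "?N * x < real k + 1" using that by (auto simp: field_simps)
    then have "\<lfloor>?N * x\<rfloor> = int k" by (simp add: floor_eq_iff)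
    then show ?thesis by (simp add: ix_def)
  qed
  have ix: "ix x < 2 ^ n \<and> x \<in> {real (ix x) / ?N..<(real (ix x) + 1) / ?N}" if "x \<in> unit_ivl" for x
  proof -
    have x: "0 \<le> ?N * x" "?N * x < ?N" using that by auto
    have "real (ix x) = of_int \<lfloor>?N * x\<rfloor>" using x by (simp add: ix_def)
    then have "real (ix x) \<le> ?N * x" "?N * x < real (ix x) + 1" by linarith+
    moreover from this have "real (ix x) < ?N" using x by linarith
    then have "ix x < 2 ^ n" by (metis of_nat_less_iff of_nat_numeral of_nat_power)
    ultimately show ?thesis by (auto simp: field_simps)
  qed
  have "\<forall>x\<in>unit_ivl. continuous (at_right x) f"
  proof
    fix x assume x: "x \<in> unit_ivl"
    let ?k = "ix x"
    have "(f \<longlongrightarrow> s ?k * x + c ?k) (at_right x)"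
    proof (rule tendsto_cong[THEN iffD2])
      have "\<forall>\<^sub>F y in at_right x. y \<in> {x<..<(real ?k + 1) / ?N}"
        using ix[OF x] by (intro eventually_at_right_real) simp
      then show "\<forall>\<^sub>F y in at_right x. f y = s ?k * y + c ?k"
        by (rule eventually_mono) (use ix[OF x] in \<open>auto intro!: aff\<close>)
    qed (auto intro!: tendsto_intros)
    then show "continuous (at_right x) f"
      using aff[of ?k x] ix[OF x] by (simp add: continuous_within)
  qed
  moreover have "f ` (dyadics \<inter> unit_ivl) \<subseteq> dyadics"
  proof
    fix y assume "y \<in> f ` (dyadics \<inter> unit_ivl)"
    then obtain m l where x: "real m / 2 ^ l \<in> unit_ivl" "y = f (real m / 2 ^ l)"
      by (auto simp: dyadics_real_iff)
    define k where "k = ix (real m / 2 ^ l)"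
    have k: "k < 2 ^ n" "real m / 2 ^ l \<in> {real k / ?N..<(real k + 1) / ?N}"
      using ix[OF x(1)] by (auto simp: k_def)
    \<comment> \<open>This inequality makes the truncated subtraction below exact, so the numerator
      is a natural number as \<open>dyadics\<close> demands.\<close>
    have "real (k * 2 ^ l) \<le> real (2 ^ n * m)" using k(2) by (simp add: field_simps)
    then have le: "k * 2 ^ l \<le> 2 ^ n * m" by (simp only: of_nat_le_iff)
    have "y = (real (j k) + (?N * (real m / 2 ^ l) - k)) / 2 ^ L k"
      unfolding x(2) by (rule jL[OF k])
    also have "real (j k) + (?N * (real m / 2 ^ l) - k)
        = real (j k * 2 ^ l + (2 ^ n * m - k * 2 ^ l)) / 2 ^ l"
      using le by (simp add: of_nat_diff add_divide_distrib diff_divide_distrib)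
    finally have "y = real (j k * 2 ^ l + (2 ^ n * m - k * 2 ^ l)) / 2 ^ (l + L k)"
      by (simp add: power_add)
    then show "y \<in> dyadics" unfolding dyadics_real_iff by blast
  qed
  moreover have nd: "unit_ivl - diff_points f \<subseteq> (\<lambda>k. real k / ?N) ` {..<2 ^ n}"
  proof
    fix x assume x: "x \<in> unit_ivl - diff_points f"
    let ?k = "ix x"
    have k: "?k < 2 ^ n" "x \<in> {real ?k / ?N..<(real ?k + 1) / ?N}" using ix x by blast+
    have "x = real ?k / ?N"
    proof (rule ccontr)
      assume "x \<noteq> real ?k / ?N"
      then have o: "x \<in> {real ?k / ?N<..<(real ?k + 1) / ?N}" using k by auto
      have "((\<lambda>x. s ?k * x + c ?k) has_field_derivative s ?k) (at x)"
        by (auto intro!: derivative_eq_intros)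
      then have "(f has_field_derivative s ?k) (at x)"
        by (rule has_field_derivative_transform_within_open[OF _ open_greaterThanLessThan o])
           (use aff[OF k(1)] in auto)
      then have "f differentiable (at x within unit_ivl)"
        using real_differentiable_def differentiable_at_withinI by blast
      then show False using x by (auto simp: diff_points_def)
    qed
    then show "x \<in> (\<lambda>k. real k / ?N) ` {..<2 ^ n}" using k(1) by blast
  qed
  moreover have "finite (unit_ivl - diff_points f)"
    by (rule finite_subset[OF nd]) simp
  moreover have "(\<lambda>k. real k / ?N) ` {..<2 ^ n} \<subseteq> dyadics"
    unfolding dyadics_real_iff image_subset_iff by blast
  moreover have "\<exists>(i::int) d. \<forall>x\<in>C. f x = 2 powi i * x + d" if C: "C \<in> components (diff_points f)" for C
  proof -
    have CD: "C \<subseteq> diff_points f" "C \<noteq> {}" "connected C"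
      using C in_components_subset in_components_nonempty in_components_connected by blast+
    have CI: "C \<subseteq> unit_ivl" using CD by (auto simp: diff_points_def)
    \<comment> \<open>The affine formula in force at \<open>x\<close>, encoded as the pair of slope
      and constant.\<close>
    define h where "h x = (s (ix x), c (ix x))" for x
    have loc: "\<forall>\<^sub>F b in at a within C. h a = h b" if a: "a \<in> C" for a
    proof -
      let ?k = "ix a"
      have aI: "a \<in> unit_ivl" using a CI by blast
      have k: "?k < 2 ^ n" "a \<in> {real ?k / ?N..<(real ?k + 1) / ?N}" using ix[OF aI] by blast+
      show ?thesis
      \<comment> \<open>The case \<open>True\<close> is a positive grid point, where two rows meet.
        Otherwise one row covers a neighbourhood of \<open>a\<close> within \<open>C\<close>; for
        index 0 the value -1 serves as a left bound beyond the unit interval.\<close>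
      proof (cases "a = real ?k / ?N \<and> ?k > 0")
        case False
        define l where "l = (if ?k = 0 then -1 else ?k / ?N)"
        have al: "a \<in> {l<..<(real ?k + 1) / ?N}" using False k aI by (auto simp: l_def)
        have "h b = h a" if "b \<in> C" "b \<in> {l<..<(real ?k + 1) / ?N}" for b
        proof -
          have "b \<in> unit_ivl" using that CI by blast
          then have "b \<in> {real ?k / ?N..<(real ?k + 1) / ?N}" using that by (auto simp: l_def split: if_splits)
          then show ?thesis using ix_eq by (simp add: h_def)
        qed
        moreover have "\<forall>\<^sub>F b in at a within C. b \<in> {l<..<(real ?k + 1) / ?N}"
          by (rule eventually_at_topological[THEN iffD2])
             (use al in \<open>intro exI[of _ "{l<..<(real ?k + 1) / ?N}"], auto\<close>)
        ultimately show ?thesis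
          unfolding eventually_at_filter by (auto elim!: eventually_mono)
      next
        case True
        define k' where "k' = ?k - 1"
        have k': "?k = Suc k'" "k' < 2 ^ n" using True k by (auto simp: k'_def)
        have ak: "a = (real k' + 1) / ?N" using True k' by simp
        have lr: "real k' / ?N < a" "a < (real ?k + 1) / ?N" using k ak by (auto simp: divide_strict_right_mono)
        have "f differentiable (at a within unit_ivl)" using a CD by (auto simp: diff_points_def)
        \<comment> \<open>Passing to the open interval turns differentiability within the half-open
          one into two-sided differentiability, as \<open>a\<close> is not 0.\<close>
        then have "f differentiable (at a within {0<..<1})"
          by (rule differentiable_within_subset) auto
        moreover have "a \<in> {0<..<1}" using aI lr by (auto intro: le_less_trans[rotated])
        ultimately have "f differentiable (at a)" using at_within_open[of a "{0<..<1}"] by simp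
        then have eq: "s k' = s ?k \<and> c k' = c ?k"
        proof (rule affine_pieces_agree[OF _ lr])
          show "f x = s k' * x + c k'" if "x \<in> {real k' / ?N<..<a}" for x
            using that ak by (intro aff k') auto
          show "f x = s ?k * x + c ?k" if "x \<in> {a..<(real ?k + 1) / ?N}" for x
            using that True by (intro aff k) auto
        qed
        have "h b = h a" if "b \<in> {real k' / ?N<..<(real ?k + 1) / ?N}" for b
        proof (cases "b < a")
          case True
          then have "ix b = k'" using that ak by (intro ix_eq) auto
          then show ?thesis using eq by (simp add: h_def)
        next
          case False
          then have "ix b = ?k" using that True by (intro ix_eq) auto
          then show ?thesis by (simp add: h_def)
        qed
        moreover have "\<forall>\<^sub>F b in at a within C. b \<in> {real k' / ?N<..<(real ?k + 1) / ?N}"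
          by (rule eventually_at_topological[THEN iffD2])
             (use lr in \<open>intro exI[of _ "{real k' / ?N<..<(real ?k + 1) / ?N}"], auto\<close>)
        ultimately show ?thesis by (auto elim!: eventually_mono)
      qed
    qed
    obtain a where a: "a \<in> C" using CD by blast
    have "f x = 2 powi (int n - int (L (ix a))) * x + c (ix a)" if x: "x \<in> C" for x
    proof -
      have "h x = h a" using connected_local_const[OF CD(3) x a] loc by blast
      then show ?thesis using aff[of "ix x" x] ix[of x] x CI by (auto simp: h_def s_def)
    qed
    then show ?thesis by blast
  qed
  ultimately show ?thesis using f(1) unfolding thompson_V_set_def by blast
qed

lemma thompson_V_set_eq: "thompson_V_set = {f \<in> Bij unit_ivl. tabular f}"
  proof (intro equalityI subsetI)
  fix f assume f: "f \<in> thompson_V_set"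
  then have "f \<in> Bij unit_ivl" unfolding thompson_V_set_def by (rule CollectE) (rule conjunct1)
  with thompson_V_set_tabular[OF f] show "f \<in> {f \<in> Bij unit_ivl. tabular f}" by blast
next
  fix f assume "f \<in> {f \<in> Bij unit_ivl. tabular f}"
  then show "f \<in> thompson_V_set" using tabular_thompson_V_set by blast
qed

section \<open>The group structure, through tables\<close>

lemma subgroup_thompson_V: "subgroup thompson_V_set (BijGroup unit_ivl)"
proof (rule group.subgroupI[OF group_BijGroup])
  show "thompson_V_set \<subseteq> carrier (BijGroup unit_ivl)"
    by (auto simp: thompson_V_set_eq BijGroup_def)
  show "thompson_V_set \<noteq> {}"
    using tabular_id id_Bij by (auto simp: thompson_V_set_eq)
next
  fix f assume f: "f \<in> thompson_V_set"
  then have fB: "f \<in> Bij unit_ivl" "tabular f" by (auto simp: thompson_V_set_eq)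
  let ?g = "inv\<^bsub>BijGroup unit_ivl\<^esub> f"
  have g: "?g = restrict (inv_into unit_ivl f) unit_ivl" by (rule inv_BijGroup[OF fB(1)])
  have "tabular ?g"
  proof (rule tabular_inverse[OF fB])
    fix x assume x: "x \<in> unit_ivl"
    then have "f x \<in> unit_ivl" by (rule Bij_in[OF fB(1)])
    moreover have "inj_on f unit_ivl" using fB by (simp add: Bij_def bij_betw_def)
    ultimately show "?g (f x) = x" unfolding g using x by (simp only: restrict_apply' inv_into_f_f)
  qed
  then show "?g \<in> thompson_V_set"
    using restrict_inv_into_Bij[OF fB(1)] by (simp only: thompson_V_set_eq g mem_Collect_eq)
next
  fix f g assume "f \<in> thompson_V_set" "g \<in> thompson_V_set"
  then show "f \<otimes>\<^bsub>BijGroup unit_ivl\<^esub> g \<in> thompson_V_set"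
    using compose_Bij[of f unit_ivl g] tabular_compose[of g f]
    by (simp add: thompson_V_set_eq BijGroup_def)
qed

lemma group_thompson_V: "group thompson_V"
  unfolding thompson_V_def
  by (rule subgroup.subgroup_is_group[OF subgroup_thompson_V group_BijGroup])

lemma carrier_thompson_V: "carrier thompson_V = {f \<in> Bij unit_ivl. tabular f}"
  by (simp add: thompson_V_def thompson_V_set_eq)

lemma mult_thompson_V:
  "f \<in> carrier thompson_V \<Longrightarrow> g \<in> carrier thompson_V \<Longrightarrow>
    f \<otimes>\<^bsub>thompson_V\<^esub> g = compose unit_ivl f g"
  by (simp add: thompson_V_def thompson_V_set_eq BijGroup_def)

lemma one_thompson_V: "\<one>\<^bsub>thompson_V\<^esub> = (\<lambda>x\<in>unit_ivl. x)"
  by (simp add: thompson_V_def BijGroup_def)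

section \<open>Permutations of the parts of a dyadic partition\<close>

lemma thompson_V_eqI:
  assumes "f \<in> carrier thompson_V" "g \<in> carrier thompson_V"
    and "\<And>x. x \<in> unit_ivl \<Longrightarrow> f x = g x"
  shows "f = g"
proof (rule extensionalityI)
  show "f \<in> extensional unit_ivl" "g \<in> extensional unit_ivl"
    using assms(1,2) by (auto simp: carrier_thompson_V dest: Bij_imp_extensional)
qed (rule assms(3))

lemma swap_word_parallel:
  assumes "p \<parallel> q" "u \<parallel> v" "\<not> strict_prefix u p" "\<not> strict_prefix u q"
    "\<not> strict_prefix v p" "\<not> strict_prefix v q"
  shows "swap_word p q u \<parallel> swap_word p q v"
  by (rule maps_cone_disjoint[OF swap_Bij[OF assms(1)] swap_maps_word swap_maps_word]) fact+

lemma swap_in_thompson_V: "u \<parallel> v \<Longrightarrow> swap u v \<in> carrier thompson_V"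
  using swap_Bij swap_tabular by (simp only: carrier_thompson_V mem_Collect_eq)

text \<open>For a finite dyadic partition \<open>P\<close> this is a copy of the symmetric group on
  \<open>P\<close>.\<close>

definition cone_perms :: "bool list set \<Rightarrow> (real \<Rightarrow> real) set" where
  "cone_perms P = {f \<in> carrier thompson_V. \<forall>u\<in>P. \<exists>v\<in>P. maps_cone f u v}"

lemma cone_perms_mult:
  assumes f: "f \<in> cone_perms P" and g: "g \<in> cone_perms P"
  shows "f \<otimes>\<^bsub>thompson_V\<^esub> g \<in> cone_perms P"
proof -
  have fg: "f \<in> carrier thompson_V" "g \<in> carrier thompson_V" using f g by (auto simp: cone_perms_def)
  have "\<exists>w\<in>P. maps_cone (f \<otimes>\<^bsub>thompson_V\<^esub> g) u w" if u: "u \<in> P" for u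
  proof -
    obtain v where v: "v \<in> P" "maps_cone g u v" using g u by (auto simp: cone_perms_def)
    then obtain w where "w \<in> P" "maps_cone f v w" using f by (auto simp: cone_perms_def)
    then show ?thesis using maps_cone_compose[OF v(2)] mult_thompson_V[OF fg] by auto
  qed
  moreover have "f \<otimes>\<^bsub>thompson_V\<^esub> g \<in> carrier thompson_V"
    using fg group_thompson_V by (intro monoid.m_closed group.is_monoid)
  ultimately show ?thesis by (simp add: cone_perms_def)
qed

text \<open>Every point lies in the cone of some word of \<open>P\<close>, so an element is
  determined by the self-map of the finite set \<open>P\<close> that it induces.\<close>

lemma finite_cone_perms:
  assumes "finite P" and cover: "\<And>w. length w = n \<Longrightarrow> \<exists>u\<in>P. prefix u w"
  shows "finite (cone_perms P)"
proof -
  define F where "F f = (\<lambda>u\<in>P. SOME v. v \<in> P \<and> maps_cone f u v)" for f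
  have F: "F f u \<in> P \<and> maps_cone f u (F f u)" if "f \<in> cone_perms P" "u \<in> P" for f u
  proof -
    have "\<exists>v. v \<in> P \<and> maps_cone f u v" using that by (auto simp: cone_perms_def)
    from someI_ex[OF this] show ?thesis using that by (simp add: F_def)
  qed
  have "inj_on F (cone_perms P)"
  proof (rule inj_onI)
    fix f g assume fg: "f \<in> cone_perms P" "g \<in> cone_perms P" "F f = F g"
    show "f = g"
    proof (rule thompson_V_eqI)
      show "f \<in> carrier thompson_V" "g \<in> carrier thompson_V" using fg by (auto simp: cone_perms_def)
      fix x assume "x \<in> unit_ivl"
      then obtain w t where w: "length w = n" "t \<in> unit_ivl" "x = cone_map w t"
        using cone_cover[of x n] by blast
      obtain u z where u: "u \<in> P" "w = u @ z" using cover[OF w(1)] by (auto simp: prefix_def)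
      define s where "s = cone_map z t"
      have s: "s \<in> unit_ivl" "x = cone_map u s"
        using cone_map_in[OF w(2)] w(3) u(2) by (simp_all add: s_def cone_map_append)
      show "f x = g x"
        using F[OF fg(1) u(1)] F[OF fg(2) u(1)] fg(3) s by (metis maps_coneD)
    qed
  qed
  moreover have "F ` cone_perms P \<subseteq> P \<rightarrow>\<^sub>E P"
    using F by (auto simp: F_def PiE_def extensional_def)
  moreover have "finite (P \<rightarrow>\<^sub>E P)" using assms(1) by (intro finite_PiE) auto
  ultimately show ?thesis by (rule inj_on_finite)
qed

lemma swap_in_cone_perms:
  assumes "p \<parallel> q" "\<And>u. u \<in> P \<Longrightarrow> \<not> strict_prefix u p \<and> \<not> strict_prefix u q \<and> swap_word p q u \<in> P"
  shows "swap p q \<in> cone_perms P"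
  using assms swap_maps_word swap_in_thompson_V by (fastforce simp: cone_perms_def)

section \<open>Generation by swaps\<close>

lemma parallel_length: "length u = length v \<Longrightarrow> u \<noteq> v \<Longrightarrow> u \<parallel> v"
  by (auto simp: parallel_def prefix_def)

section \<open>Partitions into cones\<close>

definition cone_partition :: "bool list set \<Rightarrow> bool" where
  "cone_partition P \<longleftrightarrow> finite P \<and> pairwise parallel P \<and> (\<forall>x\<in>unit_ivl. \<exists>u\<in>P. x \<in> cone u)"

lemma cone_partition_level: "cone_partition {u. length u = n}"
proof -
  have "pairwise parallel {u :: bool list. length u = n}"
    by (rule pairwiseI) (simp add: parallel_length)
  moreover have "\<exists>u\<in>{u. length u = n}. x \<in> cone u" if "x \<in> unit_ivl" for x
    using cone_cover[OF that, of n] by blast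
  ultimately show ?thesis using finite_words[of n] by (simp only: cone_partition_def) blast
qed

lemma cone_partition_image:
  assumes P: "cone_partition P" and f: "f \<in> Bij unit_ivl"
    and maps: "\<And>u. u \<in> P \<Longrightarrow> maps_cone f u (\<sigma> u)"
  shows "cone_partition (\<sigma> ` P)"
proof -
  have "pairwise parallel (\<sigma> ` P)"
  proof (rule pairwiseI)
    fix x y assume "x \<in> \<sigma> ` P" "y \<in> \<sigma> ` P" "x \<noteq> y"
    then obtain u v where "u \<in> P" "v \<in> P" "u \<noteq> v" "x = \<sigma> u" "y = \<sigma> v" by blast
    moreover from this have "u \<parallel> v" using P by (auto simp: cone_partition_def pairwise_def)
    ultimately show "x \<parallel> y" using maps_cone_disjoint[OF f maps maps] by blast
  qed
  moreover have "\<exists>v\<in>\<sigma> ` P. y \<in> cone v" if y: "y \<in> unit_ivl" for y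
  proof -
    have "y \<in> f ` unit_ivl" using f y by (simp only: Bij_def bij_betw_def Int_iff mem_Collect_eq)
    then obtain x where x: "x \<in> unit_ivl" "y = f x" by blast
    then obtain u t where u: "u \<in> P" "t \<in> unit_ivl" "x = cone_map u t"
      using P unfolding cone_partition_def by blast
    then have "y = cone_map (\<sigma> u) t" using maps_coneD[OF maps[OF u(1)] u(2)] x by simp
    then show ?thesis using u by blast
  qed
  ultimately show ?thesis using P unfolding cone_partition_def by blast
qed

text \<open>Take a longest word of \<open>P\<close> and flip its last letter. The part
  \<open>v\<close> meeting this sibling cone cannot be a proper prefix of the sibling, as it would
  then be one of the longest word too; so \<open>v\<close> extends the sibling and, by maximality,
  equals it.\<close>

lemma caret:
  assumes P: "cone_partition P" and "P \<noteq> {[]}"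
  obtains p where "\<And>b. p @ [b] \<in> P"
proof -
  have fin: "finite P" and par: "\<And>u v. u \<in> P \<Longrightarrow> v \<in> P \<Longrightarrow> u \<noteq> v \<Longrightarrow> u \<parallel> v"
    and cov: "\<And>x. x \<in> unit_ivl \<Longrightarrow> \<exists>u\<in>P. x \<in> cone u"
    using P by (auto simp: cone_partition_def pairwise_def)
  have ne: "P \<noteq> {}" using cov[of 0] by auto
  define m where "m = Max (length ` P)"
  have "m \<in> length ` P" unfolding m_def using fin ne by (intro Max_in) auto
  then obtain u where u: "u \<in> P" "length u = m" by blast
  have max: "length v \<le> m" if "v \<in> P" for v
    unfolding m_def using that fin by (intro Max_ge) auto
  have "u \<noteq> []"
  proof
    assume "u = []"
    then have "v = []" if "v \<in> P" for v using max[OF that] u by simp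
    then show False using \<open>P \<noteq> {[]}\<close> ne by blast
  qed
  then obtain p b where pb: "u = p @ [b]" by (metis rev_exhaust)
  let ?w = "p @ [\<not> b]"
  obtain v where v: "v \<in> P" "cone_map ?w 0 \<in> cone v" using cov[OF cone_map_in[of 0 ?w]] by auto
  then have "\<not> ?w \<parallel> v" using cone_disjoint[of ?w v] zero_in_cone[of ?w] by blast
  moreover have "\<not> strict_prefix v ?w"
  proof
    assume "strict_prefix v ?w"
    then have "prefix v p" by (auto simp: strict_prefix_def)
    then have "prefix v u" "v \<noteq> u" by (auto simp: pb)
    then show False using par[OF v(1) u(1)] by (simp add: parallel_def)
  qed
  ultimately have "prefix ?w v" by (auto simp: parallel_def strict_prefix_def)
  then have "?w = v" using max[OF v(1)] u(2) pb by (auto simp: prefix_def)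
  then have "p @ [c] \<in> P" for c using v(1) u(1) pb by (cases "c = b") auto
  then show thesis by (rule that)
qed

lemma maps_cone_join:
  assumes "\<And>b. maps_cone f (p @ [b]) (q @ [b])"
  shows "maps_cone f p q"
  unfolding maps_cone_def
proof
  fix t assume "t \<in> unit_ivl"
  from cone_cover[OF this, of 1] obtain z s
    where z: "length z = 1" "s \<in> unit_ivl" "t = cone_map z s" by blast
  then obtain b where "z = [b]" by (auto simp: length_Suc_conv)
  then show "f (cone_map p t) = cone_map q t"
    using maps_coneD[OF assms[of b] z(2)] z(3) by (simp only: cone_map_append)
qed

lemma cone_partition_join:
  assumes P: "cone_partition P" and p: "p @ [False] \<in> P" "p @ [True] \<in> P"
  shows "cone_partition (insert p (P - {p @ [False], p @ [True]})) \<and> p \<notin> P"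
proof -
  have par: "\<And>u v. u \<in> P \<Longrightarrow> v \<in> P \<Longrightarrow> u \<noteq> v \<Longrightarrow> u \<parallel> v"
    using P by (auto simp: cone_partition_def pairwise_def)
  have pb: "p @ [b] \<in> P" for b using p by (cases b) auto
  have pP: "p \<notin> P"
  proof
    assume "p \<in> P"
    then show False using par[of p "p @ [False]"] p by (simp add: parallel_def)
  qed
  have pu: "u \<parallel> p" if u: "u \<in> P - {p @ [False], p @ [True]}" for u
  proof -
    have ub: "u \<parallel> p @ [b]" for b using u pb by (intro par) (cases b, auto)
    have "\<not> prefix u p" using ub[of True] by (auto simp: parallel_def)
    moreover have "\<not> prefix p u"
    proof
      assume "prefix p u"
      then obtain z where "u = p @ z" by (auto simp: prefix_def)
      moreover from this have "z \<noteq> []" using u pP by auto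
      ultimately obtain b z' where "u = (p @ [b]) @ z'" by (cases z) auto
      then show False using ub[of b] by (simp add: parallel_def)
    qed
    ultimately show ?thesis by (simp add: parallel_def)
  qed
  have "pairwise parallel (insert p (P - {p @ [False], p @ [True]}))"
    using par pu by (auto simp: pairwise_insert pairwise_def parallel_commute)
  moreover have "\<exists>u\<in>insert p (P - {p @ [False], p @ [True]}). x \<in> cone u" if "x \<in> unit_ivl" for x
  proof -
    obtain u where u: "u \<in> P" "x \<in> cone u" using P \<open>x \<in> unit_ivl\<close> unfolding cone_partition_def by blast
    show ?thesis
    proof (cases "u \<in> {p @ [False], p @ [True]}")
      case True
      then have "x \<in> cone p" using u(2) cone_append_subset by blast
      then show ?thesis by blast
    next
      case False
      then show ?thesis using u by blast
    qed
  qed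
  ultimately show ?thesis using P pP unfolding cone_partition_def by blast
qed

text \<open>Generation is phrased for an arbitrary subgroup containing the four involutions, so that
  the stabiliser of a vertex can be taken for \<open>K\<close>.\<close>

locale swap_subgroup =
  fixes K :: "(real \<Rightarrow> real) set"
  assumes subgroup: "subgroup K thompson_V"
    and swaps: "swap [False, False] [False, True] \<in> K" "swap [False, True] [True, False] \<in> K"
      "swap [True, False] [True, True] \<in> K" "swap [True] [False, False] \<in> K"
begin

lemma compose_in: "f \<in> K \<Longrightarrow> g \<in> K \<Longrightarrow> compose unit_ivl f g \<in> K"
  using subgroup.m_closed[OF subgroup] subgroup.subset[OF subgroup] mult_thompson_V by fastforce

section \<open>All exchanges of disjoint cones\<close>

definition swappable :: "bool list \<Rightarrow> bool list \<Rightarrow> bool" where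
  "swappable u v \<longleftrightarrow> u \<parallel> v \<and> swap u v \<in> K"

lemma swap_commute: "u \<parallel> v \<Longrightarrow> swap u v = swap v u"
proof
  fix x assume "u \<parallel> v"
  then have "cone u \<inter> cone v = {}" by (rule cone_disjoint)
  then show "swap u v x = swap v u x" unfolding swap_def restrict_def by auto
qed

lemma swappable_sym: "swappable u v \<Longrightarrow> swappable v u"
  using swap_commute[of u v] by (auto simp: swappable_def parallel_commute)

lemma swappable_conj:
  assumes pq: "swappable p q" and uv: "u \<parallel> v"
    and "\<not> strict_prefix u p" "\<not> strict_prefix u q" "\<not> strict_prefix v p" "\<not> strict_prefix v q"
    and "swappable (swap_word p q u) (swap_word p q v)"
  shows "swappable u v"
proof -
  have p: "p \<parallel> q" "swap p q \<in> K" using pq by (auto simp: swappable_def)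
  let ?u = "swap_word p q u" and ?v = "swap_word p q v" and ?s = "swap p q"
  have uv': "?u \<parallel> ?v" "swap ?u ?v \<in> K" using assms(7) by (auto simp: swappable_def)
  have maps: "maps_cone ?s u ?u" "maps_cone ?s v ?v" using swap_maps_word p(1) assms by blast+
  have inv: "maps_cone ?s w w'" if "maps_cone ?s w' w" for w w'
    unfolding maps_cone_def using maps_coneD[OF that] swap_swap[OF p(1)] cone_map_in by metis
  have "swap u v = compose unit_ivl ?s (compose unit_ivl (swap ?u ?v) ?s)"
    using swap_conj[OF p(1) uv'(1) inv[OF maps(1)] inv[OF maps(2)]] by simp
  then show ?thesis using uv compose_in p(2) uv'(2) by (simp add: swappable_def)
qed

lemma swappable_base:
  "swappable [False, False] [False, True]" "swappable [False, True] [True, False]"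
  "swappable [True, False] [True, True]" "swappable [True] [False, False]"
  using swaps by (auto simp: swappable_def parallel_def)

text \<open>Three of the involutions are the adjacent transpositions of the four words of length
  two; conjugating them yields the remaining transpositions.\<close>

lemma swappable_level_2:
  assumes "length u = 2" "length v = 2" "u \<noteq> v"
  shows "swappable u v"
proof -
  note b = swappable_base
  have 1: "swappable [False, False] [True, False]"
    by (rule swappable_conj[OF b(2)]) (use b in \<open>auto simp: swap_word_def parallel_def strict_prefix_def\<close>)
  have 2: "swappable [False, True] [True, True]"
    by (rule swappable_conj[OF b(3)]) (use b in \<open>auto simp: swap_word_def parallel_def strict_prefix_def\<close>)
  have 3: "swappable [False, False] [True, True]"
    by (rule swappable_conj[OF b(3)]) (use b 1 in \<open>auto simp: swap_word_def parallel_def strict_prefix_def\<close>)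
  obtain a a' c c' where "u = [a, a']" "v = [c, c']"
    using assms(1,2) by (auto simp: length_Suc_conv numeral_2_eq_2)
  then show ?thesis
    using b 1 2 3 b[THEN swappable_sym] 1[THEN swappable_sym] 2[THEN swappable_sym]
      3[THEN swappable_sym] assms(3) by (cases a; cases a'; cases c; cases c') auto
qed

lemma strict_prefix_length_le: "length v \<le> length u \<Longrightarrow> \<not> strict_prefix u v"
  using prefix_length_less[of u v] by linarith

text \<open>Induction on the total length. If some word is longer than two, exchanges at depth two,
  which preserve lengths, move it below \<open>00\<close> and the other word below \<open>00\<close>
  or \<open>01\<close>; the fourth involution then removes a letter.\<close>

lemma swappable_all: "u \<parallel> v \<Longrightarrow> 2 \<le> length u \<Longrightarrow> 2 \<le> length v \<Longrightarrow> swappable u v"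
proof (induction "length u + length v" arbitrary: u v rule: less_induct)
  case less
  let ?a = "[False, False]" and ?b = "[False, True]"
  \<comment> \<open>The induction hypothesis as a closed statement, for use with any pair
    \<open>x\<close>, \<open>y\<close> of the same total length.\<close>
  define IH where "IH = (\<forall>x y. length x + length y < length u + length v \<longrightarrow> x \<parallel> y \<longrightarrow>
    2 \<le> length x \<longrightarrow> 2 \<le> length y \<longrightarrow> swappable x y)"
  have IH: IH using less.hyps by (auto simp: IH_def)
  text \<open>Conjugation by the swap of the cones of \<open>1\<close> and \<open>00\<close> shortens words beginning with
    \<open>00\<close> and does not affect those beginning with \<open>01\<close>.\<close>
  have A: "swappable x y" if xy: "x \<parallel> y" "2 < length x" "2 \<le> length y"
    "length x + length y = length u + length v" "prefix ?a x" "prefix ?a y \<or> prefix ?b y" for x y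
  proof -
    let ?s = "swap_word [True] ?a"
    obtain z where z: "x = ?a @ z" using xy(5) by (auto simp: prefix_def)
    have sx: "?s x = True # z" by (simp add: swap_word_def z)
    have x': "\<not> strict_prefix x [True]" "\<not> strict_prefix x ?a"
      "\<not> strict_prefix y [True]" "\<not> strict_prefix y ?a"
      using xy by (auto intro!: strict_prefix_length_le)
    have par: "?s x \<parallel> ?s y"
      using swappable_base(4) xy(1) x' by (auto simp: swappable_def intro!: swap_word_parallel)
    have "2 \<le> length (?s y) \<and> length (?s y) \<le> length y"
    proof (cases "prefix ?a y")
      case True
      then obtain z' where z': "y = ?a @ z'" by (auto simp: prefix_def)
      \<comment> \<open>Were \<open>z'\<close> empty, \<open>y\<close> would be a prefix of
        \<open>x\<close>; so \<open>y\<close> still has two letters after losing one.\<close>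
      have "z' \<noteq> []" using xy(1) z z' by (auto simp: parallel_def)
      then show ?thesis by (cases z') (simp_all add: swap_word_def z')
    next
      case False
      then have "prefix ?b y" using xy(6) by simp
      then show ?thesis using xy(3) by (auto simp: prefix_def swap_word_def)
    qed
    moreover have "2 \<le> length (?s x)" "length (?s x) < length x" using xy(2) sx z by (auto simp: Suc_le_eq)
    ultimately have "swappable (?s x) (?s y)" using IH par xy(4) by (auto simp: IH_def)
    then show ?thesis by (rule swappable_conj[OF swappable_base(4) xy(1) x'])
  qed
  text \<open>Swaps of cones of depth two bring the words into the form required by \<open>A\<close>.\<close>
  have level_2: "swappable x y" if xy: "x \<parallel> y" "2 \<le> length x" "2 \<le> length y"
    and pq: "length p = 2" "length q = 2" "p \<noteq> q"
    and sw: "swap_word p q x \<parallel> swap_word p q y \<Longrightarrow> swappable (swap_word p q x) (swap_word p q y)"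
    for x y p q
  proof -
    have s: "swappable p q" using swappable_level_2 pq by blast
    have x': "\<not> strict_prefix x p" "\<not> strict_prefix x q" "\<not> strict_prefix y p" "\<not> strict_prefix y q"
      using xy pq by (auto intro!: strict_prefix_length_le)
    have "swap_word p q x \<parallel> swap_word p q y"
      using s xy(1) x' by (auto simp: swappable_def intro!: swap_word_parallel)
    then show ?thesis using swappable_conj[OF s xy(1) x'] sw by blast
  qed
  have len: "length (swap_word p q x) = length x" if "length p = 2" "length q = 2" for p q x :: "bool list"
    using that by (auto simp: swap_word_def prefix_def)
  have B: "swappable x y" if xy: "x \<parallel> y" "2 < length x" "2 \<le> length y"
    "length x + length y = length u + length v" "prefix ?a x" for x y
  proof (cases "prefix ?a y \<or> prefix ?b y")
    case True
    then show ?thesis using A xy by blast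
  next
    case False
    \<comment> \<open>Here \<open>q\<close> is \<open>10\<close> or \<open>11\<close>: exchanging it
      with \<open>01\<close> moves \<open>y\<close> as required and leaves \<open>x\<close>, which
      begins with \<open>00\<close>, alone.\<close>
    define q where "q = take 2 y"
    have q: "length q = 2" "y = q @ drop 2 y" using xy(3) by (auto simp: q_def)
    then have qn: "q \<noteq> ?b" "q \<noteq> ?a" using False by (metis prefixI)+
    obtain z where z: "x = ?a @ z" using xy(5) by (auto simp: prefix_def)
    have "\<not> prefix q x" using q(1) qn z by (auto simp: prefix_def length_Suc_conv numeral_2_eq_2)
    then have sx: "swap_word q ?b x = x" by (simp add: swap_word_def z)
    have sy: "prefix ?b (swap_word q ?b y)"
      using q(2) by (metis append_eq_conv_conj prefixI swap_word_def)
    show ?thesis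
    proof (rule level_2[OF xy(1) _ xy(3) q(1) _ qn(1)])
      assume "swap_word q ?b x \<parallel> swap_word q ?b y"
      then show "swappable (swap_word q ?b x) (swap_word q ?b y)"
        unfolding sx by (rule A) (use xy sy len q in auto)
    qed (use xy in auto)
  qed
  have C: "swappable x y" if xy: "x \<parallel> y" "2 < length x" "2 \<le> length y"
    "length x + length y = length u + length v" for x y
  proof (cases "prefix ?a x")
    case True
    then show ?thesis using B xy by blast
  next
    case False
    \<comment> \<open>Exchanging the first two letters \<open>q\<close> of \<open>x\<close> with
      \<open>00\<close> may alter \<open>y\<close> as well, but not its length.\<close>
    define q where "q = take 2 x"
    have q: "length q = 2" "x = q @ drop 2 x" using xy(2) by (auto simp: q_def)
    then have qn: "q \<noteq> ?a" using False by (metis prefixI)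
    have sx: "prefix ?a (swap_word q ?a x)"
      using q(2) by (metis append_eq_conv_conj prefixI swap_word_def)
    show ?thesis
    proof (rule level_2[OF xy(1) _ xy(3) q(1) _ qn])
      assume "swap_word q ?a x \<parallel> swap_word q ?a y"
      then show "swappable (swap_word q ?a x) (swap_word q ?a y)"
        by (rule B) (use xy sx len q in auto)
    qed (use xy in auto)
  qed
  consider "2 < length u" | "2 < length v" | "length u = 2" "length v = 2" using less.prems by linarith
  then show ?case
  proof cases
    case 1
    then show ?thesis using C less.prems by simp
  next
    case 2
    then have "swappable v u" using C[of v u] less.prems by (simp add: parallel_commute add.commute)
    then show ?thesis by (rule swappable_sym)
  next
    case 3
    then show ?thesis using swappable_level_2 less.prems by (auto simp: parallel_def)
  qed
qed

text \<open>This reaches words of length one: an exchange is the product of the exchanges of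
  corresponding halves, whose words have length at least two.\<close>

lemma swap_split:
  assumes uv: "u \<parallel> v"
  shows "swap u v = compose unit_ivl (swap (u @ [False]) (v @ [False])) (swap (u @ [True]) (v @ [True]))"
proof (rule extensionalityI)
  let ?s = "\<lambda>b. swap (u @ [b]) (v @ [b])"
  show "swap u v \<in> extensional unit_ivl" by (simp add: swap_def)
  show "compose unit_ivl (?s False) (?s True) \<in> extensional unit_ivl" by (simp add: compose_def)
  fix x assume x: "x \<in> unit_ivl"
  have par: "u @ y \<parallel> v @ z" for y z using uv by (rule parallel_append)
  have par': "u @ [b] \<parallel> u @ [\<not> b]" "v @ [b] \<parallel> v @ [\<not> b]" for b by (auto simp: parallel_def)
  consider "x \<notin> cone u" "x \<notin> cone v" | b t where "t \<in> unit_ivl" "x = cone_map (u @ [b]) t"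
    | b t where "t \<in> unit_ivl" "x = cone_map (v @ [b]) t"
  proof -
    have *: "\<exists>b t. t \<in> unit_ivl \<and> x = cone_map (w @ [b]) t" if "x \<in> cone w" for w
    proof -
      obtain s where s: "s \<in> unit_ivl" "x = cone_map w s" using \<open>x \<in> cone w\<close> by blast
      obtain z t where z: "length z = 1" "t \<in> unit_ivl" "s = cone_map z t"
        using cone_cover[OF s(1), of 1] by blast
      then obtain b where "z = [b]" by (auto simp: length_Suc_conv)
      with s z show ?thesis by (auto simp: cone_map_append simp del: cone_map.simps)
    qed
    show thesis using that *[of u] *[of v] by blast
  qed
  then show "swap u v x = compose unit_ivl (?s False) (?s True) x"
  proof cases
    case 1
    have "x \<notin> cone (u @ [b])" "x \<notin> cone (v @ [b])" for b
      using 1 cone_append_subset[of u "[b]"] cone_append_subset[of v "[b]"] by blast+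
    then show ?thesis using x 1 by (simp only: compose_eq swap_outside not_False_eq_True)
  next
    case (2 b t)
    have "maps_cone (swap u v) (u @ [b]) (v @ [b])" by (rule maps_cone_append[OF swap_maps_left])
    moreover have "maps_cone (compose unit_ivl (?s False) (?s True)) (u @ [b]) (v @ [b])"
    proof (cases b)
      case True
      have "maps_cone (?s False) (v @ [True]) (v @ [True])"
        using par[of "[False]" "[True]"] par'(2)[of True] by (intro swap_maps_outside) (simp_all add: parallel_commute)
      then show ?thesis using True maps_cone_compose[OF swap_maps_left] by simp
    next
      case False
      have "maps_cone (?s True) (u @ [False]) (u @ [False])"
        using par[of "[False]" "[True]"] par'(1)[of False] by (intro swap_maps_outside) (simp_all add: parallel_commute)
      then show ?thesis using False maps_cone_compose[OF _ swap_maps_left] by simp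
    qed
    ultimately show ?thesis using 2 by (simp only: maps_coneD)
  next
    case (3 b t)
    have "maps_cone (swap u v) (v @ [b]) (u @ [b])" by (rule maps_cone_append[OF swap_maps_right[OF uv]])
    moreover have "maps_cone (compose unit_ivl (?s False) (?s True)) (v @ [b]) (u @ [b])"
    proof (cases b)
      case True
      have "maps_cone (?s False) (u @ [True]) (u @ [True])"
        using par[of "[True]" "[False]"] par'(1)[of True] by (intro swap_maps_outside) simp_all
      then show ?thesis using True maps_cone_compose[OF swap_maps_right[OF par]] by simp
    next
      case False
      have "maps_cone (?s True) (v @ [False]) (v @ [False])"
        using par[of "[True]" "[False]"] par'(2)[of False] by (intro swap_maps_outside) (simp_all add: parallel_commute)
      then show ?thesis using False maps_cone_compose[OF _ swap_maps_right[OF par]] by simp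
    qed
    ultimately show ?thesis using 3 by (simp only: maps_coneD)
  qed
qed

lemma swap_mem:
  assumes "u \<parallel> v"
  shows "swap u v \<in> K"
proof -
  have "u \<noteq> []" "v \<noteq> []" using assms by (auto simp: parallel_def)
  then have "1 \<le> length u" "1 \<le> length v" by (simp_all add: Suc_le_eq)
  moreover have "u @ [b] \<parallel> v @ [b]" for b using assms by (rule parallel_append)
  ultimately have "swap (u @ [b]) (v @ [b]) \<in> K" for b
    using swappable_all[of "u @ [b]" "v @ [b]"] by (simp add: swappable_def)
  then show ?thesis using swap_split[OF assms] compose_in by simp
qed

section \<open>Reduction of elements along partitions\<close>

lemma compose_swap_cancel:
  assumes uv: "u \<parallel> v" and f: "f \<in> carrier thompson_V"
    and K: "compose unit_ivl (swap u v) f \<in> K"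
  shows "f \<in> K"
proof -
  have fB: "f \<in> Bij unit_ivl" using f by (simp only: carrier_thompson_V mem_Collect_eq)
  have K': "compose unit_ivl (swap u v) (compose unit_ivl (swap u v) f) \<in> K"
    using compose_in[OF swap_mem[OF uv] K] .
  have "compose unit_ivl (swap u v) (compose unit_ivl (swap u v) f) = f"
  proof (rule thompson_V_eqI[OF _ f])
    show "compose unit_ivl (swap u v) (compose unit_ivl (swap u v) f) \<in> carrier thompson_V"
      using K' subgroup.subset[OF subgroup] by blast
    show "compose unit_ivl (swap u v) (compose unit_ivl (swap u v) f) x = f x" if "x \<in> unit_ivl" for x
      using that swap_swap[OF uv Bij_in[OF fB that]] by (simp only: compose_eq)
  qed
  with K' show ?thesis by simp
qed

text \<open>Composing with an exchange of two target parts sends \<open>a\<close> to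
  \<open>c\<close> and only permutes the target partition. The last clause keeps uninvolved parts in
  place, so a second use does not undo the first.\<close>

lemma move_cone:
  assumes P: "cone_partition P" and f: "f \<in> carrier thompson_V"
    and maps: "\<And>u. u \<in> P \<Longrightarrow> maps_cone f u (\<sigma> u)" and a: "a \<in> P" "c \<in> \<sigma> ` P"
  obtains g \<tau> where "g \<in> carrier thompson_V" "g \<in> K \<longrightarrow> f \<in> K"
    "\<forall>u\<in>P. maps_cone g u (\<tau> u)" "\<tau> ` P = \<sigma> ` P" "\<tau> a = c"
    "\<forall>u\<in>P. \<sigma> u \<noteq> \<sigma> a \<longrightarrow> \<sigma> u \<noteq> c \<longrightarrow> \<tau> u = \<sigma> u"
proof (cases "\<sigma> a = c")
  case True
  show thesis by (rule that[of f \<sigma>]) (use True f maps in auto)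
next
  case False
  have fB: "f \<in> Bij unit_ivl" using f by (simp only: carrier_thompson_V mem_Collect_eq)
  have Q: "pairwise parallel (\<sigma> ` P)"
    using cone_partition_image[OF P fB maps] by (simp add: cone_partition_def)
  have ac: "\<sigma> a \<parallel> c" using pairwiseD[OF Q] a False by blast
  define g where "g = compose unit_ivl (swap (\<sigma> a) c) f"
  define \<tau> where "\<tau> u = (if \<sigma> u = \<sigma> a then c else if \<sigma> u = c then \<sigma> a else \<sigma> u)" for u
  show thesis
  proof (rule that[of g \<tau>])
    show "g \<in> carrier thompson_V" unfolding g_def
      using mult_thompson_V[OF swap_in_thompson_V[OF ac] f]
        monoid.m_closed[OF group.is_monoid[OF group_thompson_V] swap_in_thompson_V[OF ac] f] by simp
    show "g \<in> K \<longrightarrow> f \<in> K" unfolding g_def using compose_swap_cancel[OF ac f] by (rule impI)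
    show "\<forall>u\<in>P. maps_cone g u (\<tau> u)"
    proof
      fix u assume u: "u \<in> P"
      have "maps_cone (swap (\<sigma> a) c) (\<sigma> u) (\<tau> u)"
      proof -
        consider "\<sigma> u = \<sigma> a" | "\<sigma> u = c" | "\<sigma> u \<noteq> \<sigma> a" "\<sigma> u \<noteq> c" by blast
        then show ?thesis
        proof cases
          case 1
          then show ?thesis using swap_maps_left by (simp add: \<tau>_def)
        next
          case 2
          then show ?thesis using swap_maps_right[OF ac] False by (simp add: \<tau>_def)
        next
          case 3
          have "\<sigma> u \<parallel> \<sigma> a" "\<sigma> u \<parallel> c" using pairwiseD[OF Q] 3 u a by blast+
          then show ?thesis using 3 swap_maps_outside by (simp add: \<tau>_def)
        qed
      qed
      then show "maps_cone g u (\<tau> u)" unfolding g_def by (rule maps_cone_compose[OF maps[OF u]])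
    qed
    obtain e where e: "e \<in> P" "c = \<sigma> e" using a by blast
    show "\<tau> ` P = \<sigma> ` P"
    proof (intro equalityI subsetI)
      fix x assume "x \<in> \<tau> ` P"
      then show "x \<in> \<sigma> ` P" using a by (auto simp: \<tau>_def)
    next
      fix x assume "x \<in> \<sigma> ` P"
      then obtain u where u: "u \<in> P" "x = \<sigma> u" by blast
      consider "x = \<sigma> a" | "x = c" | "x \<noteq> \<sigma> a" "x \<noteq> c" by blast
      then show "x \<in> \<tau> ` P"
      proof cases
        case 1
        then have "x = \<tau> e" using e False by (simp add: \<tau>_def)
        then show ?thesis using e by blast
      next
        case 2
        then have "x = \<tau> a" by (simp add: \<tau>_def)
        then show ?thesis using a by blast
      next
        case 3
        then have "x = \<tau> u" using u by (simp add: \<tau>_def)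
        then show ?thesis using u by blast
      qed
    qed
  qed (auto simp: \<tau>_def)
qed

text \<open>Once two sibling parts go to two sibling parts in the right order, both pairs merge and
  the partition shrinks. The induction varies \<open>f\<close> and its table too, because each step
  replaces them.\<close>

lemma partition_map_in:
  "cone_partition P \<Longrightarrow> f \<in> carrier thompson_V \<Longrightarrow> (\<And>u. u \<in> P \<Longrightarrow> maps_cone f u (\<sigma> u)) \<Longrightarrow> f \<in> K"
proof (induction "card P" arbitrary: P f \<sigma> rule: less_induct)
  case less
  note P = less.prems(1) and f = less.prems(2) and maps = less.prems(3)
  have fB: "f \<in> Bij unit_ivl" using f by (simp only: carrier_thompson_V mem_Collect_eq)
  have Q: "cone_partition (\<sigma> ` P)" by (rule cone_partition_image[OF P fB maps])
  show ?case
  proof (cases "P = {[]}")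
    case True
    \<comment> \<open>The image of the trivial partition covers the interval by a single cone, which
      forces the empty word and hence the identity.\<close>
    then have "unit_ivl \<subseteq> cone (\<sigma> [])" using Q by (auto simp: cone_partition_def)
    then have "cone [] \<subseteq> cone (\<sigma> [])" by simp
    then have "\<sigma> [] = []" using cone_subset_imp_prefix[of "[]" "\<sigma> []"] by simp
    then have "maps_cone f [] []" using maps[of "[]"] True by simp
    then have "f x = x" if "x \<in> unit_ivl" for x using maps_coneD[of f "[]" "[]" x] that by simp
    then have "f = \<one>\<^bsub>thompson_V\<^esub>"
      using thompson_V_eqI[OF f monoid.one_closed[OF group.is_monoid[OF group_thompson_V]]]
      by (simp add: one_thompson_V)
    then show ?thesis using subgroup.one_closed[OF subgroup] by simp
  next
    case False
    obtain p where p: "p @ [b] \<in> P" for b using caret[OF P False] by metis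
    \<comment> \<open>Two disjoint siblings cannot both go to the whole interval; hence the target
      partition has a sibling pair as well.\<close>
    have "\<sigma> ` P \<noteq> {[]}"
    proof
      assume "\<sigma> ` P = {[]}"
      then have "\<sigma> (p @ [True]) = []" "\<sigma> (p @ [False]) = []" using p by blast+
      then have "maps_cone f (p @ [True]) []" "maps_cone f (p @ [False]) []" 
        using maps[OF p[of True]] maps[OF p[of False]] by simp_all
      moreover have "p @ [True] \<parallel> p @ [False]" by (auto simp: parallel_def)
      ultimately have "[] \<parallel> ([] :: bool list)" by (rule maps_cone_disjoint[OF fB])
      then show False by simp
    qed
    then obtain q where q: "q @ [b] \<in> \<sigma> ` P" for b using caret[OF Q] by metis
    obtain g \<tau> where g: "g \<in> carrier thompson_V" "g \<in> K \<longrightarrow> f \<in> K"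
      "\<forall>u\<in>P. maps_cone g u (\<tau> u)" "\<tau> ` P = \<sigma> ` P" "\<tau> (p @ [False]) = q @ [False]"
      by (rule move_cone[OF P f maps p[of False] q[of False]])
    have gmaps: "maps_cone g u (\<tau> u)" if "u \<in> P" for u using g(3) that by blast
    have qT: "q @ [True] \<in> \<tau> ` P" using q g(4) by blast
    obtain h \<rho> where h: "h \<in> carrier thompson_V" "h \<in> K \<longrightarrow> g \<in> K"
      "\<forall>u\<in>P. maps_cone h u (\<rho> u)" "\<rho> (p @ [True]) = q @ [True]"
      "\<forall>u\<in>P. \<tau> u \<noteq> \<tau> (p @ [True]) \<longrightarrow> \<tau> u \<noteq> q @ [True] \<longrightarrow> \<rho> u = \<tau> u"
      by (rule move_cone[OF P g(1) gmaps p[of True] qT])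
    have hmaps: "maps_cone h u (\<rho> u)" if "u \<in> P" for u using h(3) that by blast
    have gB: "g \<in> Bij unit_ivl" using g(1) by (simp only: carrier_thompson_V mem_Collect_eq)
    have "\<tau> (p @ [False]) \<parallel> \<tau> (p @ [True])"
      by (rule maps_cone_disjoint[OF gB gmaps[OF p] gmaps[OF p]]) (auto simp: parallel_def)
    then have "\<tau> (p @ [False]) \<noteq> \<tau> (p @ [True])" by (auto simp: parallel_def)
    \<comment> \<open>The second exchange involves neither the image of the \<open>False\<close>
      sibling nor its target, so the first placement survives.\<close>
    then have "\<rho> (p @ [False]) = q @ [False]" using h(5) p[of False] g(5) by simp
    then have "maps_cone h (p @ [b]) (q @ [b])" for b
      using hmaps[OF p[of b]] h(4) by (cases b) simp_all
    then have pq: "maps_cone h p q" by (rule maps_cone_join)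
    let ?R = "P - {p @ [False], p @ [True]}" and ?\<rho> = "\<rho>(p := q)"
    have join: "cone_partition (insert p ?R)" "p \<notin> P"
      using cone_partition_join[OF P p[of False] p[of True]] by blast+
    have "card (insert p ?R) \<le> Suc (card ?R)" by (rule card_insert_le_m1) simp_all
    also have "card ?R = card P - 2"
      using P p[of False] p[of True] by (subst card_Diff_subset) (auto simp: cone_partition_def)
    finally have "card (insert p ?R) \<le> Suc (card P - 2)" .
    moreover have "2 \<le> card P"
      using card_mono[of P "{p @ [False], p @ [True]}"] P p by (auto simp: cone_partition_def)
    ultimately have "card (insert p ?R) < card P" by linarith
    then have "h \<in> K"
    proof (rule less.hyps[OF _ join(1) h(1)])
      show "maps_cone h u (?\<rho> u)" if "u \<in> insert p ?R" for u
        using that pq hmaps join(2) by auto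
    qed
    then show ?thesis using g(2) h(2) by blast
  qed
qed

lemma eq_carrier: "K = carrier thompson_V"
proof
  show "K \<subseteq> carrier thompson_V" by (rule subgroup.subset[OF subgroup])
  show "carrier thompson_V \<subseteq> K"
  proof
    fix f assume f: "f \<in> carrier thompson_V"
    then obtain n where n: "\<forall>u. length u = n \<longrightarrow> (\<exists>v. maps_cone f u v)"
      by (auto simp: carrier_thompson_V tabular_def)
    then obtain \<sigma> where "\<And>u. length u = n \<Longrightarrow> maps_cone f u (\<sigma> u)" by metis
    then show "f \<in> K" using partition_map_in[OF cone_partition_level[of n] f] by blast
  qed
qed

end

section \<open>Property FA\<close>

lemma fixed_vertex_cone_perms:
  assumes "simplicial_tree_action thompson_V X E \<phi>" and P: "finite P"
    "\<And>w. length w = n \<Longrightarrow> \<exists>u\<in>P. prefix u w"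
  obtains v where "v \<in> X" "\<forall>h\<in>cone_perms P. \<phi> h v = v"
proof -
  interpret simplicial_tree_action thompson_V X E \<phi> by fact
  have "\<one>\<^bsub>thompson_V\<^esub> \<in> cone_perms P"
  proof -
    have "maps_cone \<one>\<^bsub>thompson_V\<^esub> u u" for u
      unfolding maps_cone_def one_thompson_V using cone_map_in by (metis restrict_apply')
    then show ?thesis
      using monoid.one_closed[OF group.is_monoid[OF group_thompson_V]] by (auto simp: cone_perms_def)
  qed
  then have "cone_perms P \<noteq> {}" by blast
  moreover have "cone_perms P \<subseteq> carrier thompson_V" by (auto simp: cone_perms_def)
  ultimately show thesis
    using fixed_vertex_of_finite[OF finite_cone_perms[OF P]] cone_perms_mult that by metis
qed

theorem theorem4p4:
  shows "property_FA TYPE('v) thompson_V"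
  unfolding property_FA_def
proof (intro conjI allI impI)
  show "group thompson_V" by (rule group_thompson_V)
  fix X :: "'v set" and E \<phi>
  assume act: "simplicial_tree_action thompson_V X E \<phi>"
  interpret simplicial_tree_action thompson_V X E \<phi> by (rule act)
  let ?F = False and ?T = True
  let ?a = "swap [?F, ?F] [?F, ?T]" and ?b = "swap [?F, ?T] [?T, ?F]"
    and ?c = "swap [?T, ?F] [?T, ?T]" and ?d = "swap [?T] [?F, ?F]"
  have V: "?a \<in> carrier thompson_V" "?b \<in> carrier thompson_V"
    "?c \<in> carrier thompson_V" "?d \<in> carrier thompson_V"
    by (auto simp: parallel_def intro!: swap_in_thompson_V)
  have words: "\<exists>x y z. w = [x, y, z]" if "length w = 3" for w :: "bool list"
    using that by (auto simp: length_Suc_conv numeral_3_eq_3)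
  have split: "(\<forall>x. Q x) \<longleftrightarrow> Q ?F \<and> Q ?T" for Q :: "bool \<Rightarrow> bool"
    by (metis (full_types))
  \<comment> \<open>\<open>?Q\<close> splits \<open>00\<close> because \<open>?d\<close> matches its
    halves with \<open>10\<close> and \<open>11\<close>; \<open>?R\<close> also splits
    \<open>01\<close>, because \<open>?a\<close> matches its halves with those of
    \<open>00\<close>.\<close>
  let ?P = "{[?F, ?F], [?F, ?T], [?T, ?F], [?T, ?T]}"
  let ?Q = "{[?F, ?F, ?F], [?F, ?F, ?T], [?F, ?T], [?T, ?F], [?T, ?T]}"
  let ?R = "{[?F, ?F, ?F], [?F, ?F, ?T], [?F, ?T, ?F], [?F, ?T, ?T], [?T, ?F], [?T, ?T]}"
  have cover: "\<exists>u\<in>?P. prefix u w" "\<exists>u\<in>?Q. prefix u w" "\<exists>u\<in>?R. prefix u w"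
    if "length w = 3" for w
    using words[OF that] by (auto simp: split)
  obtain p where p: "p \<in> X" "\<forall>h\<in>cone_perms ?P. \<phi> h p = p"
    by (rule fixed_vertex_cone_perms[OF act _ cover(1)]) simp_all
  obtain q where q: "q \<in> X" "\<forall>h\<in>cone_perms ?Q. \<phi> h q = q"
    by (rule fixed_vertex_cone_perms[OF act _ cover(2)]) simp_all
  obtain r where r: "r \<in> X" "\<forall>h\<in>cone_perms ?R. \<phi> h r = r"
    by (rule fixed_vertex_cone_perms[OF act _ cover(3)]) simp_all
  have "?a \<in> cone_perms ?P" "?b \<in> cone_perms ?P" "?c \<in> cone_perms ?P"
    by (rule swap_in_cone_perms; auto simp: parallel_def strict_prefix_def swap_word_def)+
  then have fp: "\<phi> ?a p = p" "\<phi> ?b p = p" "\<phi> ?c p = p" using p by blast+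
  have "?b \<in> cone_perms ?Q" "?d \<in> cone_perms ?Q"
    by (rule swap_in_cone_perms; auto simp: parallel_def strict_prefix_def swap_word_def)+
  then have fq: "\<phi> ?b q = q" "\<phi> ?d q = q" using q by blast+
  have "?a \<in> cone_perms ?R" "?c \<in> cone_perms ?R" "?d \<in> cone_perms ?R"
    by (rule swap_in_cone_perms; auto simp: parallel_def strict_prefix_def swap_word_def)+
  then have fr: "\<phi> ?a r = r" "\<phi> ?c r = r" "\<phi> ?d r = r" using r by blast+
  \<comment> \<open>Each involution fixes two of the three vertices: \<open>?a\<close> and
    \<open>?c\<close> fix \<open>p\<close> and \<open>r\<close>, \<open>?b\<close> fixes
    \<open>p\<close> and \<open>q\<close>, \<open>?d\<close> fixes \<open>q\<close> and
    \<open>r\<close>.\<close>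
  obtain m where m: "between p m q" "between p m r" "between q m r"
    by (rule median[OF p(1) q(1) r(1)])
  have mX: "m \<in> X" using m(1) by (simp add: between_def)
  have "\<phi> ?a m = m" "\<phi> ?c m = m"
    using fix_between[OF _ p(1) r(1) _ _ m(2)] V fp fr by blast+
  moreover have "\<phi> ?b m = m" using fix_between[OF _ p(1) q(1) _ _ m(1)] V fp fq by blast
  moreover have "\<phi> ?d m = m" using fix_between[OF _ q(1) r(1) _ _ m(3)] V fq fr by blast
  ultimately have "swap_subgroup (stabilizer thompson_V \<phi> m)"
    using V stabilizer_subgroup[OF mX] by (simp add: swap_subgroup_def stabilizer_def)
  then have "stabilizer thompson_V \<phi> m = carrier thompson_V" by (rule swap_subgroup.eq_carrier)
  then have "\<phi> g m = m" if "g \<in> carrier thompson_V" for g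
    using that by (auto simp: stabilizer_def)
  then have "orbit thompson_V \<phi> m = {m}"
    unfolding orbit_def using monoid.one_closed[OF group.is_monoid[OF group_thompson_V]] by force
  with mX show "\<exists>v\<in>X. orbit thompson_V \<phi> v = {v}" by blast
qed

end
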